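(* Let $n\ge 1$. In the Tamari lattice $\operatorname{Tam}_n$ of size $n$, there are: \begin{itemize} \item $\displaystyle \frac{1}{n+1}\binom{2n}{n}$ linear intervals of height $0$, \item $\displaystyle \binom{2n-1}{n-2}$ linear intervals of height $1$, \item $\displaystyle 2\binom{2n-k}{n-k-1}$ linear intervals of height $k$, for $2\le k<n$. \end{itemize} Furthermore, there are no linear intervals of height $k\ge n$. This adds up to $$\frac{1}{n+1}\binom{2n}{n}+\binom{2n-1}{n-2}+2\binom{2n-1}{n+2}$$ linear intervals in $\operatorname{Tam}_n$.
   Context: Binomial coefficients $\binom{a}{b}$ with $b<0$ or $b>a$ are $0$. Intervals. In a finite poset, for $P\le Q$ the interval $[P,Q]$ is the set of $R$ with $P\le R\le Q$. Its height is the maximal length $k$ of a chain $P=P_0<P_1<\dots<P_k=Q$. It is linear if it is totally ordered. Tamari lattice. A tree is a planar rooted binary tree; its size is its number of (internal) nodes, each node having a left and a right son (each a node or a leaf). $\operatorname{Tam}_n$ is the set of trees of size $n$ ordered by the reflexive transitive closure of left rotations, where a left rotation at a node replaces, somewhere in the tree, a subtree of the form $(B,(C,D))$ by $((B,C),D)$ (here $(X,Y)$ denotes the tree whose root node has left subtree $X$ and right subtree $Y$, and $B,C,D$ are trees, possibly reduced to a leaf); the rotated tree is the larger one. *)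

theory Defs
  imports Complex_Main "HOL-Library.Tree"
begin

text \<open>
  A finite poset is given by its order relation \<open>r\<close> as a set of pairs; the relation is
  reflexive on its carrier, so the carrier is recovered as \<open>Field r\<close>.
\<close>

definition interval :: "'a rel \<Rightarrow> 'a \<Rightarrow> 'a \<Rightarrow> 'a set" where
  "interval r P Q = {R. (P, R) \<in> r \<and> (R, Q) \<in> r}"

definition interval_height :: "'a rel \<Rightarrow> 'a \<Rightarrow> 'a \<Rightarrow> nat" where
  "interval_height r P Q = Max {k. \<exists>c :: nat \<Rightarrow> 'a. c 0 = P \<and> c k = Q \<and>
     (\<forall>i<k. (c i, c (Suc i)) \<in> r \<and> c i \<noteq> c (Suc i))}"

text \<open>Intervals are counted as sets; by antisymmetry this is the same as counting pairs of endpoints.\<close>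

definition linear_intervals :: "'a rel \<Rightarrow> 'a set set" where
  "linear_intervals r = {interval r P Q | P Q. (P, Q) \<in> r \<and> total_on (interval r P Q) r}"

definition linear_intervals_of_height :: "'a rel \<Rightarrow> nat \<Rightarrow> 'a set set" where
  "linear_intervals_of_height r k = {interval r P Q | P Q.
     (P, Q) \<in> r \<and> total_on (interval r P Q) r \<and> interval_height r P Q = k}"

text \<open>Planar rooted binary trees carry no labels, hence the label type \<^typ>\<open>unit\<close>.\<close>

type_synonym bin_tree = "unit tree"

inductive left_rotation :: "bin_tree \<Rightarrow> bin_tree \<Rightarrow> bool" where
  at_root: "left_rotation \<langle>B, (), \<langle>C, (), D\<rangle>\<rangle> \<langle>\<langle>B, (), C\<rangle>, (), D\<rangle>"
| in_left: "left_rotation L L' \<Longrightarrow> left_rotation \<langle>L, (), R\<rangle> \<langle>L', (), R\<rangle>"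
| in_right: "left_rotation R R' \<Longrightarrow> left_rotation \<langle>L, (), R\<rangle> \<langle>L, (), R'\<rangle>"

definition Tam :: "nat \<Rightarrow> bin_tree set" where
  "Tam n = {t. size t = n}"

definition tamari_order :: "nat \<Rightarrow> bin_tree rel" where
  "tamari_order n = {(P, Q). P \<in> Tam n \<and> Q \<in> Tam n \<and> left_rotation\<^sup>*\<^sup>* P Q}"

text \<open>
  Binomial coefficient with integer arguments, zero if \<open>b < 0\<close> or \<open>b > a\<close>.  Integer
  arguments are needed because truncated subtraction on \<^typ>\<open>nat\<close> would turn
  \<open>n - 2\<close> into \<open>0\<close> for \<open>n = 1\<close>.
\<close>

definition int_binomial :: "int \<Rightarrow> int \<Rightarrow> nat" where
  "int_binomial a b = (if b < 0 \<or> b > a then 0 else nat a choose nat b)"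

lemma left_rotation_size: "left_rotation P Q \<Longrightarrow> size P = size Q"
  by (induction rule: left_rotation.induct) auto

lemma left_rotations_size: "left_rotation\<^sup>*\<^sup>* P Q \<Longrightarrow> size P = size Q"
  by (induction rule: rtranclp_induct) (auto dest: left_rotation_size)

lemma finite_Tam: "finite (Tam n)"
proof (induction n rule: less_induct)
  case (less n)
  have "Tam n \<subseteq> {\<langle>\<rangle>} \<union> (\<lambda>(l, r). \<langle>l, (), r\<rangle>) ` ((\<Union>i<n. Tam i) \<times> (\<Union>i<n. Tam i))"
  proof
    fix t assume "t \<in> Tam n"
    then show "t \<in> {\<langle>\<rangle>} \<union> (\<lambda>(l, r). \<langle>l, (), r\<rangle>) ` ((\<Union>i<n. Tam i) \<times> (\<Union>i<n. Tam i))"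
      by (cases t) (auto simp: Tam_def)
  qed
  moreover have "finite \<dots>"
    using less by auto
  ultimately show ?case
    by (rule finite_subset)
qed

primrec left_weight :: "bin_tree \<Rightarrow> nat" where
  "left_weight \<langle>\<rangle> = 0"
| "left_weight \<langle>L, x, R\<rangle> = size L + left_weight L + left_weight R"

lemma left_rotation_left_weight: "left_rotation P Q \<Longrightarrow> left_weight P < left_weight Q"
  by (induction rule: left_rotation.induct) (auto dest: left_rotation_size)

lemma left_rotations_left_weight:
  "left_rotation\<^sup>*\<^sup>* P Q \<Longrightarrow> P = Q \<or> left_weight P < left_weight Q"
  by (induction rule: rtranclp_induct) (auto dest: left_rotation_left_weight)

lemma partial_order_on_tamari_order: "partial_order_on (Tam n) (tamari_order n)"
proof -
  have "antisym (tamari_order n)"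
    by (rule antisymI) (auto simp: tamari_order_def dest!: left_rotations_left_weight)
  then show ?thesis
    by (auto simp: order_on_defs refl_on_def tamari_order_def intro!: transI)
qed

end

theory Submission
  imports Defs
begin

text \<open>
  A linear interval of height \<open>k \<ge> 2\<close> has one of two shapes. Up to a common context, either its
  bottom is \<open>(B, (((C, D\<^sub>k), \<dots>), D\<^sub>1))\<close> and its top is \<open>((((B, C), D\<^sub>k), \<dots>), D\<^sub>1)\<close>, so that one node
  slides down the left branch of its right son, always rotating at that node; or it is the mirror
  image of such an interval, in which one node climbs up a right branch. For \<open>k = 1\<close> both shapes
  describe a single rotation, and for \<open>k \<ge> 2\<close> no interval has both.

  These intervals are linear. Number the nodes of a tree in infix order and record the size of
  the right subtree of each. A left rotation decreases exactly one of these numbers, and the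
  rotation is determined by the node concerned (\<open>right_size_rotation_at\<close>, \<open>rotation_at_unique\<close>).
  In an interval of the first shape only one of the numbers varies, so from each element at most
  one rotation stays in the interval. The mirror image turns this into the statement
  for the second shape.

  Conversely, from an element of a linear interval at most one rotation stays in the interval,
  because two different rotations of one tree have incomparable results. Take a rotation followed by an interval of one of the
  two shapes. If they do not fit together to a longer interval of such a shape, then a
  commutation, or a pentagon of the Tamari order, yields a second rotation of the bottom element
  that stays below the top (\<open>rotation_then_slide\<close>, \<open>rotation_then_climb\<close>). Induction on the height
  gives the classification \<open>linear_interval_iff\<close>.

  An interval of the first shape and of height \<open>k\<close> is given by a context and \<open>k + 2\<close> trees whose
  sizes add up to \<open>n - k - 1\<close>. Let \<open>f r m\<close> be the number of contexts with \<open>r\<close> trees of total size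
  \<open>m\<close>. Splitting the first tree at its root gives \<open>f (r + 1) m = f r m + f (r + 2) (m - 1)\<close>, and
  removing the outermost layer of the context gives \<open>f 0 m = 2 * f 1 (m - 1)\<close>, both for \<open>m > 0\<close>; hence
  \<open>f r m = (2 * m + r choose m)\<close> by Pascal's rule. The same recursion without the context yields
  the Catalan numbers, which count the intervals of height \<open>0\<close>.
\<close>

section \<open>Left rotations and right subtree sizes\<close>

text \<open>The Tamari order, on the trees of all sizes at once.\<close>

abbreviation rotations :: "bin_tree \<Rightarrow> bin_tree \<Rightarrow> bool" where
  "rotations \<equiv> left_rotation\<^sup>*\<^sup>*"

lemma rotations_left: "rotations L L' \<Longrightarrow> rotations \<langle>L, (), R\<rangle> \<langle>L', (), R\<rangle>"
  by (induction rule: rtranclp_induct) (auto intro: rtranclp.rtrancl_into_rtrancl in_left)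

lemma rotations_right: "rotations R R' \<Longrightarrow> rotations \<langle>L, (), R\<rangle> \<langle>L, (), R'\<rangle>"
  by (induction rule: rtranclp_induct) (auto intro: rtranclp.rtrancl_into_rtrancl in_right)

lemma rotations_sons:
  "rotations L L' \<Longrightarrow> rotations R R' \<Longrightarrow> rotations \<langle>L, (), R\<rangle> \<langle>L', (), R'\<rangle>"
  by (rule rtranclp_trans[OF rotations_left rotations_right])

lemma rotations_root:
  "rotations B B' \<Longrightarrow> rotations C C' \<Longrightarrow> rotations D D'
    \<Longrightarrow> rotations \<langle>B, (), \<langle>C, (), D\<rangle>\<rangle> \<langle>\<langle>B', (), C'\<rangle>, (), D'\<rangle>"
  by (rule converse_rtranclp_into_rtranclp, rule at_root) (intro rotations_sons)

lemma rotations_antisym: "rotations P Q \<Longrightarrow> rotations Q P \<Longrightarrow> P = Q"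
  by (auto dest!: left_rotations_left_weight)

text \<open>A left rotation together with the infix number, counted from \<open>0\<close>, of the node that moves down.\<close>

inductive rotation_at :: "nat \<Rightarrow> bin_tree \<Rightarrow> bin_tree \<Rightarrow> bool" where
  "rotation_at (size B) \<langle>B, (), \<langle>C, (), D\<rangle>\<rangle> \<langle>\<langle>B, (), C\<rangle>, (), D\<rangle>"
| "rotation_at i L L' \<Longrightarrow> rotation_at i \<langle>L, (), R\<rangle> \<langle>L', (), R\<rangle>"
| "rotation_at i R R' \<Longrightarrow> rotation_at (Suc (size L + i)) \<langle>L, (), R\<rangle> \<langle>L, (), R'\<rangle>"

lemma rotation_at_less_size: "rotation_at i P Q \<Longrightarrow> i < size P"
  by (induction rule: rotation_at.induct) auto

lemma rotation_at_imp_left_rotation: "rotation_at i P Q \<Longrightarrow> left_rotation P Q"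
  by (induction rule: rotation_at.induct) (auto intro: left_rotation.intros)

lemma left_rotation_imp_rotation_at: "left_rotation P Q \<Longrightarrow> \<exists>i. rotation_at i P Q"
  by (induction rule: left_rotation.induct) (auto intro: rotation_at.intros)

lemma rotation_at_unique: "rotation_at i P Q \<Longrightarrow> rotation_at i P Q' \<Longrightarrow> Q = Q'"
proof (induction P arbitrary: i Q Q')
  case (Node L x R)
  note at_cases = rotation_at.cases[of _ "\<langle>L, x, R\<rangle>"]
  from Node.prems(1) show ?case
  proof (cases rule: rotation_at.cases)
    case 1
    from Node.prems(2) show ?thesis
      by (cases rule: rotation_at.cases) (use 1 in \<open>auto dest: rotation_at_less_size\<close>)
  next
    case (2 L')
    from Node.prems(2) show ?thesis
      by (cases rule: rotation_at.cases)
        (use 2 rotation_at_less_size[OF 2(3)] Node.IH(1) in auto)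
  next
    case (3 j R')
    from Node.prems(2) show ?thesis
      by (cases rule: rotation_at.cases) (use 3 Node.IH(2) in \<open>auto dest: rotation_at_less_size\<close>)
  qed
qed (auto elim: rotation_at.cases)

text \<open>The size of the right subtree of the node with infix number \<open>i\<close>, and \<open>0\<close> if there is no such node.\<close>

fun right_size :: "bin_tree \<Rightarrow> nat \<Rightarrow> nat" where
  "right_size \<langle>\<rangle> i = 0"
| "right_size \<langle>L, _, R\<rangle> i =
    (if i < size L then right_size L i
     else if i = size L then size R else right_size R (i - Suc (size L)))"

lemma right_size_rotation_at:
  "rotation_at i P Q \<Longrightarrow> right_size Q i < right_size P i"
  "rotation_at i P Q \<Longrightarrow> j \<noteq> i \<Longrightarrow> right_size Q j = right_size P j"
proof -
  have "right_size Q i < right_size P i \<and> (\<forall>j. j \<noteq> i \<longrightarrow> right_size Q j = right_size P j)"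
    if "rotation_at i P Q"
    using that
  proof (induction rule: rotation_at.induct)
    case (1 B C D)
    then show ?case by (auto simp: less_Suc_eq not_less intro!: gr0I)
  next
    case (2 i L L' R)
    then show ?case
      using left_rotation_size[OF rotation_at_imp_left_rotation[OF "2.hyps"]] rotation_at_less_size[OF "2.hyps"] by simp
  next
    case (3 i R R' L)
    then show ?case
      using left_rotation_size[OF rotation_at_imp_left_rotation[OF "3.hyps"]] rotation_at_less_size[OF "3.hyps"] by auto
  qed
  then show "rotation_at i P Q \<Longrightarrow> right_size Q i < right_size P i"
    "rotation_at i P Q \<Longrightarrow> j \<noteq> i \<Longrightarrow> right_size Q j = right_size P j" by auto
qed

lemma right_size_rotations: "rotations P Q \<Longrightarrow> right_size Q j \<le> right_size P j"
proof (induction rule: rtranclp_induct)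
  case (step Q R)
  then obtain i where "rotation_at i Q R" using left_rotation_imp_rotation_at by blast
  then have "right_size R j \<le> right_size Q j"
    using right_size_rotation_at by (cases "j = i") (auto intro: less_imp_le)
  with step.IH show ?case by simp
qed simp

section \<open>Linear intervals and detours\<close>

text \<open>\<open>P\<close> is below \<open>Q\<close> and the interval between them is a chain, without reference to the size.\<close>

definition linear_interval :: "bin_tree \<Rightarrow> bin_tree \<Rightarrow> bool" where
  "linear_interval P Q \<longleftrightarrow> rotations P Q \<and>
    (\<forall>R S. rotations P R \<longrightarrow> rotations R Q \<longrightarrow> rotations P S \<longrightarrow> rotations S Q
        \<longrightarrow> rotations R S \<or> rotations S R)"

text \<open>
  A second way to start from \<open>P\<close> towards \<open>Q\<close>: a rotation of \<open>P\<close> other than the one to \<open>P\<^sub>1\<close>,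
  with a result that is still below \<open>Q\<close>.
\<close>

definition detour :: "bin_tree \<Rightarrow> bin_tree \<Rightarrow> bin_tree \<Rightarrow> bool" where
  "detour P P\<^sub>1 Q \<longleftrightarrow> (\<exists>P'. P' \<noteq> P\<^sub>1 \<and> left_rotation P P' \<and> rotations P' Q)"

lemma left_rotations_incomparable:
  assumes "left_rotation P Q" "left_rotation P R" "rotations Q R"
  shows "Q = R"
proof -
  obtain i j where i: "rotation_at i P Q" and j: "rotation_at j P R"
    using assms left_rotation_imp_rotation_at by blast
  show ?thesis
  proof (cases "i = j")
    case True
    with i j show ?thesis using rotation_at_unique by blast
  next
    case False
    have "right_size R i \<le> right_size Q i" using assms(3) right_size_rotations by blast
    also have "\<dots> < right_size P i" using right_size_rotation_at(1)[OF i] .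
    finally show ?thesis using right_size_rotation_at(2)[OF j False] by simp
  qed
qed

lemma linear_no_detour:
  assumes "linear_interval P Q" "left_rotation P P\<^sub>1" "rotations P\<^sub>1 Q"
  shows "\<not> detour P P\<^sub>1 Q"
proof
  assume "detour P P\<^sub>1 Q"
  then obtain P' where P': "P' \<noteq> P\<^sub>1" "left_rotation P P'" "rotations P' Q"
    unfolding detour_def by blast
  with assms have "rotations P' P\<^sub>1 \<or> rotations P\<^sub>1 P'"
    unfolding linear_interval_def by blast
  with P' assms(2) show False using left_rotations_incomparable by blast
qed

lemma linear_subinterval:
  "linear_interval P Q \<Longrightarrow> rotations P P' \<Longrightarrow> rotations P' Q' \<Longrightarrow> rotations Q' Q \<Longrightarrow> linear_interval P' Q'"
  unfolding linear_interval_def by (meson rtranclp_trans)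

lemma linear_rotation_at_pow:
  assumes "(rotation_at i ^^ k) P Q"
  shows "linear_interval P Q"
proof -
  have rots: "rotations P Q \<and> (\<forall>j. j \<noteq> i \<longrightarrow> right_size Q j = right_size P j)"
    if "(rotation_at i ^^ k) P Q" for k P Q
    using that
  proof (induction k arbitrary: Q)
    case (Suc k)
    then obtain R where "(rotation_at i ^^ k) P R" "rotation_at i R Q" by auto
    with Suc.IH[of R] show ?case
      using right_size_rotation_at(2) rotation_at_imp_left_rotation
      by (metis rtranclp.rtrancl_into_rtrancl)
  qed auto
  \<comment> \<open>a rotation at another node would decrease a right subtree size on which \<open>P\<close> and \<open>Q\<close> agree\<close>
  have only: "rotation_at i R R'"
    if R: "rotations P R" "left_rotation R R'" "rotations R' Q" for R R'
  proof -
    obtain j where j: "rotation_at j R R'" using left_rotation_imp_rotation_at R(2) by blast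
    have "right_size Q j \<le> right_size R' j" "right_size R j \<le> right_size P j"
      using R right_size_rotations by blast+
    with right_size_rotation_at(1)[OF j] rots[OF assms] have "j = i" by force
    with j show ?thesis by simp
  qed
  have "rotations R S \<or> rotations S R"
    if "rotations P R" "rotations R Q" "rotations P S" "rotations S Q" for R S
    using that
  proof (induction rule: rtranclp_induct)
    case (step R R')
    then have "rotations R S \<or> rotations S R"
      by (meson converse_rtranclp_into_rtranclp)
    then show ?case
    proof
      assume "rotations R S"
      then show ?thesis
      proof (cases rule: converse_rtranclpE)
        case base
        with step show ?thesis by blast
      next
        case (step T)
        then have "rotation_at i R T" "rotation_at i R R'"
          using only \<open>rotations P R\<close> \<open>left_rotation R R'\<close> \<open>rotations R' Q\<close> \<open>rotations S Q\<close>
          by (meson rtranclp_trans)+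
        with step show ?thesis using rotation_at_unique by blast
      qed
    qed (use step in \<open>meson rtranclp.rtrancl_into_rtrancl\<close>)
  qed simp
  with rots[OF assms] show ?thesis unfolding linear_interval_def by blast
qed

section \<open>The two shapes of linear intervals\<close>

text \<open>The closure of a relation under putting both trees into a common context.\<close>

inductive somewhere :: "(bin_tree \<Rightarrow> bin_tree \<Rightarrow> bool) \<Rightarrow> bin_tree \<Rightarrow> bin_tree \<Rightarrow> bool" for r where
  here: "r P Q \<Longrightarrow> somewhere r P Q"
| left: "somewhere r L L' \<Longrightarrow> somewhere r \<langle>L, (), R\<rangle> \<langle>L', (), R\<rangle>"
| right: "somewhere r R R' \<Longrightarrow> somewhere r \<langle>L, (), R\<rangle> \<langle>L, (), R'\<rangle>"

text \<open>
  \<open>slide k P Q\<close>: the root of \<open>P\<close> is rotated \<open>k\<close> times to the left, moving down the left branch of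
  its right son. For \<open>k = 0\<close> the tree \<open>P\<close> is still required to have a root node.
\<close>

inductive slide :: "nat \<Rightarrow> bin_tree \<Rightarrow> bin_tree \<Rightarrow> bool" where
  slide_0: "slide 0 \<langle>B, (), C\<rangle> \<langle>B, (), C\<rangle>"
| slide_Suc: "slide k \<langle>B, (), C\<rangle> Y \<Longrightarrow> slide (Suc k) \<langle>B, (), \<langle>C, (), D\<rangle>\<rangle> \<langle>Y, (), D\<rangle>"

text \<open>
  \<open>climb k P Q\<close>: a node at depth \<open>k\<close> on the right branch of \<open>P\<close> moves up to the root by \<open>k\<close>
  rotations. This is the mirror image of \<open>slide k\<close>, with bottom and top exchanged.
\<close>

inductive climb :: "nat \<Rightarrow> bin_tree \<Rightarrow> bin_tree \<Rightarrow> bool" where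
  climb_0: "climb 0 \<langle>C, (), B\<rangle> \<langle>C, (), B\<rangle>"
| climb_Suc: "climb k Y \<langle>C, (), B\<rangle> \<Longrightarrow> climb (Suc k) \<langle>D, (), Y\<rangle> \<langle>\<langle>D, (), C\<rangle>, (), B\<rangle>"

lemma slide_rotation_at: "slide k \<langle>B, (), X\<rangle> Y \<Longrightarrow> (rotation_at (size B) ^^ k) \<langle>B, (), X\<rangle> Y"
proof (induction k "\<langle>B, (), X\<rangle>" Y arbitrary: X rule: slide.induct)
  case (slide_Suc k C Y D)
  have left: "(rotation_at i ^^ j) \<langle>L, (), D\<rangle> \<langle>L', (), D\<rangle>" if "(rotation_at i ^^ j) L L'" for i j L L'
    using that
  proof (induction j arbitrary: L')
    case (Suc j)
    then show ?case by (auto intro!: relcomppI rotation_at.intros(2))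
  qed simp
  show ?case
    using relpowp_Suc_I2[OF rotation_at.intros(1) left[OF slide_Suc.hyps(2)]] .
qed auto

lemma somewhere_slide_rotation_at:
  "somewhere (slide k) P Q \<Longrightarrow> \<exists>i. (rotation_at i ^^ k) P Q"
proof (induction rule: somewhere.induct)
  case (here P Q)
  then show ?case using slide_rotation_at by (metis slide.cases)
next
  case (left L L' R)
  then obtain i where "(rotation_at i ^^ k) L L'" by blast
  then have "(rotation_at i ^^ k) \<langle>L, (), R\<rangle> \<langle>L', (), R\<rangle>"
    by (induction k arbitrary: L') (auto intro!: relcomppI rotation_at.intros(2))
  then show ?case ..
next
  case (right R R' L)
  then obtain i where "(rotation_at i ^^ k) R R'" by blast
  then have "(rotation_at (Suc (size L + i)) ^^ k) \<langle>L, (), R\<rangle> \<langle>L, (), R'\<rangle>"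
    by (induction k arbitrary: R') (auto intro!: relcomppI rotation_at.intros(3))
  then show ?case ..
qed

lemma linear_somewhere_slide: "somewhere (slide k) P Q \<Longrightarrow> linear_interval P Q"
  using somewhere_slide_rotation_at linear_rotation_at_pow by blast

lemma somewhere_slide_relpowp: "somewhere (slide k) P Q \<Longrightarrow> (left_rotation ^^ k) P Q"
  using somewhere_slide_rotation_at relpowp_mono rotation_at_imp_left_rotation by metis

lemma left_rotation_mirror: "left_rotation P Q \<Longrightarrow> left_rotation (mirror Q) (mirror P)"
  by (induction rule: left_rotation.induct) (auto intro: left_rotation.intros)

lemma rotations_mirror: "rotations P Q \<Longrightarrow> rotations (mirror Q) (mirror P)"
  by (induction rule: rtranclp_induct)
    (auto intro: converse_rtranclp_into_rtranclp left_rotation_mirror)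

lemma linear_mirror: "linear_interval P Q \<Longrightarrow> linear_interval (mirror Q) (mirror P)"
  unfolding linear_interval_def by (metis mirror_mirror rotations_mirror)

lemma relpowp_left_rotation_mirror:
  "(left_rotation ^^ k) P Q \<Longrightarrow> (left_rotation ^^ k) (mirror Q) (mirror P)"
proof (induction k arbitrary: Q)
  case (Suc k)
  then show ?case by (blast elim: relpowp_Suc_E intro: relpowp_Suc_I2 left_rotation_mirror)
qed simp

lemma slide_imp_climb_mirror: "slide k P Q \<Longrightarrow> climb k (mirror Q) (mirror P)"
  by (induction rule: slide.induct) (auto intro: climb.intros)

lemma climb_imp_slide_mirror: "climb k P Q \<Longrightarrow> slide k (mirror Q) (mirror P)"
  by (induction rule: climb.induct) (auto intro: slide.intros)

lemma somewhere_mirror: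
  assumes "\<And>P Q. r P Q \<Longrightarrow> s (mirror Q) (mirror P)" "somewhere r P Q"
  shows "somewhere s (mirror Q) (mirror P)"
  using assms(2) by (induction rule: somewhere.induct) (auto intro: somewhere.intros assms(1))

lemma somewhere_climb_iff_mirror:
  "somewhere (climb k) P Q \<longleftrightarrow> somewhere (slide k) (mirror Q) (mirror P)"
  using somewhere_mirror[of "climb k" "slide k" P Q]
    somewhere_mirror[of "slide k" "climb k" "mirror Q" "mirror P"]
    climb_imp_slide_mirror slide_imp_climb_mirror by auto

lemma linear_somewhere_climb: "somewhere (climb k) P Q \<Longrightarrow> linear_interval P Q"
  unfolding somewhere_climb_iff_mirror using linear_somewhere_slide linear_mirror
  by (metis mirror_mirror)

lemma somewhere_climb_relpowp: "somewhere (climb k) P Q \<Longrightarrow> (left_rotation ^^ k) P Q"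
  unfolding somewhere_climb_iff_mirror
  using somewhere_slide_relpowp relpowp_left_rotation_mirror by (metis mirror_mirror)

lemma somewhere_slide_1_iff: "somewhere (slide 1) P Q \<longleftrightarrow> left_rotation P Q"
proof
  assume "left_rotation P Q"
  then show "somewhere (slide 1) P Q"
    by (induction rule: left_rotation.induct) (auto intro: somewhere.intros slide.intros)
qed (use somewhere_slide_relpowp in force)

lemma somewhere_climb_1_iff: "somewhere (climb 1) P Q \<longleftrightarrow> left_rotation P Q"
  unfolding somewhere_climb_iff_mirror somewhere_slide_1_iff
  using left_rotation_mirror by (metis mirror_mirror)

lemma slide_NodeE:
  assumes "slide m \<langle>B, (), X\<rangle> Q"
  obtains "m = 0" "Q = \<langle>B, (), X\<rangle>"
  | k C D Y where "m = Suc k" "X = \<langle>C, (), D\<rangle>" "Q = \<langle>Y, (), D\<rangle>" "slide k \<langle>B, (), C\<rangle> Y"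
  using assms by (cases rule: slide.cases) auto

lemma climb_NodeE:
  assumes "climb m \<langle>D, (), X\<rangle> Q"
  obtains "m = 0" "Q = \<langle>D, (), X\<rangle>"
  | k B C where "m = Suc k" "Q = \<langle>\<langle>D, (), C\<rangle>, (), B\<rangle>" "climb k X \<langle>C, (), B\<rangle>"
  using assms by (cases rule: climb.cases) auto

lemma somewhere_NodeE:
  assumes "somewhere r \<langle>L, (), R\<rangle> Q"
  obtains "r \<langle>L, (), R\<rangle> Q"
  | L' where "Q = \<langle>L', (), R\<rangle>" "somewhere r L L'"
  | R' where "Q = \<langle>L, (), R'\<rangle>" "somewhere r R R'"
  using assms by (cases rule: somewhere.cases) auto

lemma slide_rotations: "slide k P Q \<Longrightarrow> rotations P Q"
  using somewhere_slide_relpowp here relpowp_imp_rtranclp by metis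

lemma climb_rotations: "climb k P Q \<Longrightarrow> rotations P Q"
  using somewhere_climb_relpowp here relpowp_imp_rtranclp by metis

lemma slide_size: "slide k P Q \<Longrightarrow> size P = size Q"
  using slide_rotations left_rotations_size by blast

lemma climb_size: "climb k P Q \<Longrightarrow> size P = size Q"
  using climb_rotations left_rotations_size by blast

lemma relpowp_first:
  assumes "(left_rotation ^^ m) P Q" "0 < m"
  obtains P' where "left_rotation P P'" "rotations P' Q"
  using assms by (metis gr0_conv_Suc relpowp_Suc_E2 relpowp_imp_rtranclp)

lemmas somewhere_slide_first = relpowp_first[OF somewhere_slide_relpowp]
lemmas somewhere_climb_first = relpowp_first[OF somewhere_climb_relpowp]

section \<open>Classification of the linear intervals\<close>

lemma detour_left: "detour L L' L'' \<Longrightarrow> detour \<langle>L, (), R\<rangle> \<langle>L', (), R\<rangle> \<langle>L'', (), R\<rangle>"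
  unfolding detour_def by (blast intro: in_left rotations_left)

lemma detour_right: "detour R R' R'' \<Longrightarrow> detour \<langle>L, (), R\<rangle> \<langle>L, (), R'\<rangle> \<langle>L, (), R''\<rangle>"
  unfolding detour_def by (blast intro: in_right rotations_right)

lemma detour_mono: "detour P P\<^sub>1 Q \<Longrightarrow> rotations Q Q' \<Longrightarrow> detour P P\<^sub>1 Q'"
  unfolding detour_def by (blast intro: rtranclp_trans)

text \<open>
  A nontrivial path that starts inside the right subtree begins with a rotation that leaves the
  left subtree alone, hence differs from a rotation that changes the left subtree.
\<close>

lemma detour_via_right:
  assumes "rotations R R'" "R \<noteq> R'" "rotations \<langle>L, (), R'\<rangle> Q" "L \<noteq> L\<^sub>1"
  shows "detour \<langle>L, (), R\<rangle> \<langle>L\<^sub>1, (), R\<^sub>1\<rangle> Q"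
proof -
  obtain S where "left_rotation R S" "rotations S R'"
    using assms(1,2) by (blast elim: converse_rtranclpE)
  with assms(3,4) show ?thesis
    unfolding detour_def by (intro exI[of _ "\<langle>L, (), S\<rangle>"])
      (auto intro: in_right rtranclp_trans[OF rotations_right])
qed

lemma detour_via_left:
  assumes "rotations L L'" "L \<noteq> L'" "rotations \<langle>L', (), R\<rangle> Q" "R \<noteq> R\<^sub>1"
  shows "detour \<langle>L, (), R\<rangle> \<langle>L\<^sub>1, (), R\<^sub>1\<rangle> Q"
proof -
  obtain S where "left_rotation L S" "rotations S L'"
    using assms(1,2) by (blast elim: converse_rtranclpE)
  with assms(3,4) show ?thesis
    unfolding detour_def by (intro exI[of _ "\<langle>S, (), R\<rangle>"])
      (auto intro: in_left rtranclp_trans[OF rotations_left])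
qed

lemma detour_via_root:
  assumes "rotations \<langle>\<langle>B, (), C\<rangle>, (), D\<rangle> Q" "P\<^sub>1 \<noteq> \<langle>\<langle>B, (), C\<rangle>, (), D\<rangle>"
  shows "detour \<langle>B, (), \<langle>C, (), D\<rangle>\<rangle> P\<^sub>1 Q"
  using assms unfolding detour_def by (metis at_root)

lemma left_rotation_neq: "left_rotation P Q \<Longrightarrow> P \<noteq> Q"
  by (auto dest: left_rotation_left_weight)

lemma somewhere_slide_neq: "somewhere (slide m) P Q \<Longrightarrow> 0 < m \<Longrightarrow> P \<noteq> Q"
  by (metis left_rotation_neq rotations_antisym somewhere_slide_first r_into_rtranclp)

lemma somewhere_climb_neq: "somewhere (climb m) P Q \<Longrightarrow> 0 < m \<Longrightarrow> P \<noteq> Q"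
  by (metis left_rotation_neq rotations_antisym somewhere_climb_first r_into_rtranclp)

lemma somewhere_slide_rotations: "somewhere (slide m) P Q \<Longrightarrow> rotations P Q"
  using somewhere_slide_relpowp relpowp_imp_rtranclp by metis

lemma somewhere_climb_rotations: "somewhere (climb m) P Q \<Longrightarrow> rotations P Q"
  using somewhere_climb_relpowp relpowp_imp_rtranclp by metis

lemma Node_neq_son: "\<langle>L, x, R\<rangle> \<noteq> L" "L \<noteq> \<langle>L, x, R\<rangle>" "\<langle>L, x, R\<rangle> \<noteq> R" "R \<noteq> \<langle>L, x, R\<rangle>"
  by (auto dest: arg_cong[where f = size])

lemma root_rotations:
  "rotations \<langle>\<langle>B, (), C\<rangle>, (), D\<rangle> Q \<Longrightarrow> rotations \<langle>B, (), \<langle>C, (), D\<rangle>\<rangle> Q"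
  by (rule converse_rtranclp_into_rtranclp, rule at_root)

text \<open>
  Prepending a rotation to a slide. Either the rotation commutes with the beginning of the
  slide, or they run along one side of a pentagon whose other side is a detour, or they fit
  together to a longer slide or, if the slide is a single rotation, to a climb.
\<close>

lemma rotation_then_slide:
  assumes "left_rotation P P\<^sub>1" "somewhere (slide m) P\<^sub>1 Q" "0 < m"
  shows "detour P P\<^sub>1 Q \<or> somewhere (slide (Suc m)) P Q \<or> (m = 1 \<and> somewhere (climb 2) P Q)"
  using assms
proof (induction arbitrary: Q rule: left_rotation.induct)
  case (at_root B C D)
  from at_root.prems(1) show ?case
  proof (cases rule: somewhere_NodeE)
    case 1
    then obtain k D\<^sub>1 D\<^sub>2 Y where D: "D = \<langle>D\<^sub>1, (), D\<^sub>2\<rangle>" "Q = \<langle>Y, (), D\<^sub>2\<rangle>"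
      and Y: "slide k \<langle>\<langle>B, (), C\<rangle>, (), D\<^sub>1\<rangle> Y"
      using at_root.prems(2) by (auto elim: slide_NodeE)
    \<comment> \<open>the long side of the pentagon starts with the rotation of \<open>(C, (D\<^sub>1, D\<^sub>2))\<close>\<close>
    have "rotations \<langle>B, (), \<langle>C, (), D\<^sub>1\<rangle>\<rangle> Y"
      using root_rotations[OF slide_rotations[OF Y]] .
    then have "rotations \<langle>B, (), \<langle>\<langle>C, (), D\<^sub>1\<rangle>, (), D\<^sub>2\<rangle>\<rangle> Q"
      unfolding D by (intro root_rotations[OF rotations_left])
    then have "detour \<langle>B, (), \<langle>C, (), D\<rangle>\<rangle> \<langle>\<langle>B, (), C\<rangle>, (), D\<rangle> Q"
      unfolding D(1) by (intro detour_via_right[where R' = "\<langle>\<langle>C, (), D\<^sub>1\<rangle>, (), D\<^sub>2\<rangle>"])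
        (auto simp: Node_neq_son intro: left_rotation.at_root)
    then show ?thesis ..
  next
    case (2 Y)
    from 2(2) show ?thesis
    proof (cases rule: somewhere_NodeE)
      case 1
      then show ?thesis unfolding 2(1) by (blast intro: here slide_Suc)
    next
      case B: (2 B')
      then show ?thesis
        unfolding 2(1) B(1) using at_root.prems(2)
        by (intro disjI1 detour_via_left[where L' = B'])
         (auto intro: somewhere_slide_rotations left_rotation.at_root simp: somewhere_slide_neq Node_neq_son)
    next
      case C: (3 C')
      then show ?thesis
        unfolding 2(1) C(1) using at_root.prems(2)
        by (intro disjI1 detour_via_right[where R' = "\<langle>C', (), D\<rangle>"])
         (auto intro: somewhere_slide_rotations left_rotation.at_root rotations_left simp: somewhere_slide_neq Node_neq_son)
    qed
  next
    case D: (3 D')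
    then show ?thesis
      unfolding D(1) using at_root.prems(2)
      by (intro disjI1 detour_via_right[where R' = "\<langle>C, (), D'\<rangle>"])
       (auto intro: somewhere_slide_rotations left_rotation.at_root rotations_right simp: somewhere_slide_neq Node_neq_son)
  qed
next
  case (in_left L L' R)
  from in_left.prems(1) show ?case
  proof (cases rule: somewhere_NodeE)
    case 1
    then obtain k R\<^sub>1 R\<^sub>2 Y where R: "R = \<langle>R\<^sub>1, (), R\<^sub>2\<rangle>" "Q = \<langle>Y, (), R\<^sub>2\<rangle>"
      and Y: "slide k \<langle>L', (), R\<^sub>1\<rangle> Y"
      using in_left.prems(2) by (auto elim: slide_NodeE)
    have "rotations \<langle>L, (), R\<^sub>1\<rangle> Y"
      using in_left.hyps slide_rotations[OF Y]
      by (meson converse_rtranclp_into_rtranclp left_rotation.in_left)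
    then show ?thesis
      unfolding R by (intro disjI1 detour_via_root rotations_left) (auto simp: Node_neq_son)
  next
    case (2 L'')
    then show ?thesis
      using in_left.IH[OF 2(2) in_left.prems(2)] by (blast intro: detour_left somewhere.left)
  next
    case (3 R')
    then show ?thesis
      unfolding 3(1) using in_left.prems(2) in_left.hyps
      by (intro disjI1 detour_via_right[where R' = R'])
       (auto intro: somewhere_slide_rotations left_rotation.in_left dest: left_rotation_neq simp: somewhere_slide_neq)
  qed
next
  case (in_right R R' L)
  from in_right.prems(1) show ?case
  proof (cases rule: somewhere_NodeE)
    case 1
    then obtain k C D Y where m: "m = Suc k" and R': "R' = \<langle>C, (), D\<rangle>" and Q: "Q = \<langle>Y, (), D\<rangle>"
      and Y: "slide k \<langle>L, (), C\<rangle> Y"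
      using in_right.prems(2) by (auto elim: slide_NodeE)
    from in_right.hyps[unfolded R'] show ?thesis
    proof (cases rule: left_rotation.cases)
      case (at_root R\<^sub>1 R\<^sub>2)
      from Y show ?thesis
      proof (cases rule: slide_NodeE)
        case 1
        have "climb 2 \<langle>L, (), R\<rangle> Q"
          unfolding at_root(1) Q 1(2) numeral_2_eq_2 using at_root(2)
          by (auto intro: climb.intros)
        with 1 m show ?thesis by (auto intro: here)
      next
        case (2 k' C\<^sub>1 C\<^sub>2 Y')
        then have Y': "slide k' \<langle>L, (), R\<^sub>1\<rangle> Y'" "Y = \<langle>Y', (), R\<^sub>2\<rangle>" using at_root by auto
        have "rotations \<langle>\<langle>L, (), R\<^sub>1\<rangle>, (), \<langle>R\<^sub>2, (), D\<rangle>\<rangle> Q"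
          unfolding Q Y'(2) using rotations_root[OF slide_rotations[OF Y'(1)]] by blast
        then show ?thesis
          unfolding at_root(1) R' by (intro disjI1 detour_via_root) (auto simp: Node_neq_son)
      qed
    next
      case (in_left C')
      have "rotations \<langle>\<langle>L, (), C'\<rangle>, (), D\<rangle> Q"
        unfolding Q using in_left(2) slide_rotations[OF Y]
        by (meson converse_rtranclp_into_rtranclp left_rotation.in_right rotations_left)
      then show ?thesis
        unfolding in_left(1) R' by (intro disjI1 detour_via_root) (auto simp: Node_neq_son)
    next
      case (in_right D')
      have "rotations \<langle>\<langle>L, (), C\<rangle>, (), D'\<rangle> Q"
        unfolding Q using in_right(2) slide_rotations[OF Y]
        by (meson r_into_rtranclp rotations_sons)
      then show ?thesis
        unfolding in_right(1) R' by (intro disjI1 detour_via_root) (auto simp: Node_neq_son)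
    qed
  next
    case (2 L')
    then show ?thesis
      unfolding 2(1) using in_right.prems(2) in_right.hyps
      by (intro disjI1 detour_via_left[where L' = L'])
       (auto intro: somewhere_slide_rotations left_rotation.in_right dest: left_rotation_neq simp: somewhere_slide_neq)
  next
    case (3 R'')
    then show ?thesis
      using in_right.IH[OF 3(2) in_right.prems(2)] by (blast intro: detour_right somewhere.right)
  qed
qed

text \<open>
  Prepending a rotation to a climb that ends at the right son \<open>(C, D)\<close> of a larger tree, which is
  the situation inside a climb that is one step longer. In the third alternative the
  larger tree can be rotated at its root first.
\<close>

lemma rotation_then_climb_root:
  assumes "left_rotation R R'" "climb j R' \<langle>C, (), D\<rangle>"
  shows "climb (Suc j) R \<langle>C, (), D\<rangle> \<or> detour R R' \<langle>C, (), D\<rangle>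
    \<or> (\<exists>C' D'. R = \<langle>C', (), D'\<rangle> \<and> rotations C' C \<and> rotations D' D)"
  using assms
proof (induction arbitrary: j C rule: left_rotation.induct)
  case (at_root R\<^sub>1 R\<^sub>2 Y)
  from at_root.prems show ?case
  proof (cases rule: climb_NodeE)
    case 1
    then show ?thesis by (auto intro: climb.intros)
  next
    case (2 k D' F)
    then have F: "rotations Y \<langle>F, (), D\<rangle>" "C = \<langle>\<langle>R\<^sub>1, (), R\<^sub>2\<rangle>, (), F\<rangle>"
      by (auto dest: climb_rotations)
    have "rotations \<langle>R\<^sub>2, (), Y\<rangle> \<langle>\<langle>R\<^sub>2, (), F\<rangle>, (), D\<rangle>"
      by (rule rtranclp_trans[OF rotations_right[OF F(1)]]) (auto intro: left_rotation.intros)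
    moreover have "rotations \<langle>R\<^sub>1, (), \<langle>\<langle>R\<^sub>2, (), F\<rangle>, (), D\<rangle>\<rangle> \<langle>C, (), D\<rangle>"
      unfolding F(2) by (meson converse_rtranclp_into_rtranclp left_rotation.intros rtranclp.rtrancl_refl)
    moreover have "\<langle>R\<^sub>2, (), Y\<rangle> \<noteq> \<langle>\<langle>R\<^sub>2, (), F\<rangle>, (), D\<rangle>" by (auto simp: Node_neq_son)
    ultimately show ?thesis
      using detour_via_right[of "\<langle>R\<^sub>2, (), Y\<rangle>"] by (metis Node_neq_son(2))
  qed
next
  case (in_left E E' Y)
  from in_left.prems show ?case
  proof (cases rule: climb_NodeE)
    case 1
    with in_left.hyps show ?thesis by auto
  next
    case (2 k D' F)
    then have F: "rotations Y \<langle>F, (), D\<rangle>" "C = \<langle>E', (), F\<rangle>"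
      by (auto dest: climb_rotations)
    have rots: "rotations \<langle>\<langle>E, (), F\<rangle>, (), D\<rangle> \<langle>C, (), D\<rangle>"
      unfolding F(2) using in_left.hyps by (meson r_into_rtranclp rotations_left)
    show ?thesis
    proof (cases "Y = \<langle>F, (), D\<rangle>")
      case True
      then show ?thesis using rots by (auto intro!: detour_via_root simp: Node_neq_son)
    next
      case False
      have "rotations \<langle>E, (), \<langle>F, (), D\<rangle>\<rangle> \<langle>C, (), D\<rangle>"
        using rots by (meson converse_rtranclp_into_rtranclp at_root)
      then show ?thesis
        using detour_via_right[OF F(1) False] left_rotation_neq[OF in_left.hyps] by blast
    qed
  qed
next
  case (in_right Y Y' E)
  from in_right.prems show ?case
  proof (cases rule: climb_NodeE)
    case 1
    with in_right.hyps show ?thesis by auto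
  next
    case (2 k D' F)
    then have j: "j = Suc k" and F: "climb k Y' \<langle>F, (), D\<rangle>" "C = \<langle>E, (), F\<rangle>" by auto
    have rot: "rotations \<langle>E, (), \<langle>F, (), D\<rangle>\<rangle> \<langle>C, (), D\<rangle>" unfolding F(2) by (auto intro: at_root)
    from in_right.IH[OF F(1)] show ?thesis
    proof (elim disjE exE conjE)
      assume "climb (Suc k) Y \<langle>F, (), D\<rangle>"
      then show ?thesis unfolding j F(2) by (auto intro: climb_Suc)
    next
      assume "detour Y Y' \<langle>F, (), D\<rangle>"
      then show ?thesis using detour_right detour_mono rot by blast
    next
      fix F' D' assume Y: "Y = \<langle>F', (), D'\<rangle>" "rotations F' F" "rotations D' D"
      then show ?thesis
        unfolding Y(1) F(2)
        by (intro disjI2 disjI1 detour_via_root rotations_sons) (auto simp: Node_neq_son)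
    qed
  qed
qed

text \<open>The analogue of \<open>rotation_then_slide\<close> for a climb.\<close>

lemma rotation_then_climb:
  assumes "left_rotation P P\<^sub>1" "somewhere (climb m) P\<^sub>1 Q" "0 < m"
  shows "detour P P\<^sub>1 Q \<or> somewhere (climb (Suc m)) P Q \<or> (m = 1 \<and> somewhere (slide 2) P Q)"
  using assms
proof (induction arbitrary: Q rule: left_rotation.induct)
  case (at_root B C D)
  from at_root.prems(1) show ?case
  proof (cases rule: somewhere_NodeE)
    case 1
    then obtain k E F where Q: "Q = \<langle>\<langle>\<langle>B, (), C\<rangle>, (), E\<rangle>, (), F\<rangle>"
      and D: "rotations D \<langle>E, (), F\<rangle>"
      using at_root.prems(2) by (metis climb_NodeE climb_rotations less_irrefl)
    \<comment> \<open>below the fixed left subtree \<open>B\<close>, the climb can be carried out first\<close>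
    have "rotations \<langle>C, (), D\<rangle> \<langle>\<langle>C, (), E\<rangle>, (), F\<rangle>"
      by (rule rtranclp_trans[OF rotations_right[OF D]]) (auto intro: left_rotation.at_root)
    moreover have "rotations \<langle>B, (), \<langle>\<langle>C, (), E\<rangle>, (), F\<rangle>\<rangle> Q"
      unfolding Q by (meson converse_rtranclp_into_rtranclp left_rotation.intros rtranclp.rtrancl_refl)
    ultimately show ?thesis
      by (intro disjI1 detour_via_right[where R' = "\<langle>\<langle>C, (), E\<rangle>, (), F\<rangle>"])
        (auto simp: Node_neq_son)
  next
    case (2 Y)
    from 2(2) show ?thesis
    proof (cases rule: somewhere_NodeE)
      case 1
      then obtain k E F where m: "m = Suc k" and Y: "Y = \<langle>\<langle>B, (), E\<rangle>, (), F\<rangle>"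
        and C: "climb k C \<langle>E, (), F\<rangle>"
        using at_root.prems(2) by (auto elim: climb_NodeE)
      show ?thesis
      proof (cases "k = 0")
        case True
        then have "C = \<langle>E, (), F\<rangle>" using C by (auto elim: climb.cases)
        then have "slide 2 \<langle>B, (), \<langle>C, (), D\<rangle>\<rangle> Q"
          unfolding 2(1) Y numeral_2_eq_2 by (auto intro: slide.intros)
        with True m show ?thesis by (auto intro: here)
      next
        case False
        have "rotations \<langle>B, (), \<langle>\<langle>E, (), F\<rangle>, (), D\<rangle>\<rangle> Q"
          unfolding 2(1) Y by (meson converse_rtranclp_into_rtranclp left_rotation.intros rtranclp.rtrancl_refl)
        moreover have "C \<noteq> \<langle>E, (), F\<rangle>" using C False here somewhere_climb_neq by blast
        ultimately show ?thesis
          by (intro disjI1 detour_via_right[where R' = "\<langle>\<langle>E, (), F\<rangle>, (), D\<rangle>"])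
            (auto simp: Node_neq_son intro: rotations_left climb_rotations[OF C])
      qed
    next
      case B: (2 B')
      then show ?thesis
        unfolding 2(1) B(1) using at_root.prems(2)
        by (intro disjI1 detour_via_left[where L' = B'])
         (auto intro: somewhere_climb_rotations left_rotation.at_root simp: somewhere_climb_neq Node_neq_son)
    next
      case C: (3 C')
      then show ?thesis
        unfolding 2(1) C(1) using at_root.prems(2)
        by (intro disjI1 detour_via_right[where R' = "\<langle>C', (), D\<rangle>"])
         (auto intro: somewhere_climb_rotations left_rotation.at_root rotations_left simp: somewhere_climb_neq Node_neq_son)
    qed
  next
    case D: (3 D')
    then show ?thesis
      unfolding D(1) using at_root.prems(2)
      by (intro disjI1 detour_via_right[where R' = "\<langle>C, (), D'\<rangle>"])
       (auto intro: somewhere_climb_rotations left_rotation.at_root rotations_right simp: somewhere_climb_neq Node_neq_son)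
  qed
next
  case (in_left L L' R)
  from in_left.prems(1) show ?case
  proof (cases rule: somewhere_NodeE)
    case 1
    then obtain k C D where Q: "Q = \<langle>\<langle>L', (), C\<rangle>, (), D\<rangle>" and R: "rotations R \<langle>C, (), D\<rangle>"
      using in_left.prems(2) by (metis climb_NodeE climb_rotations less_irrefl)
    have rots: "rotations \<langle>\<langle>L, (), C\<rangle>, (), D\<rangle> Q"
      unfolding Q using in_left.hyps by (meson r_into_rtranclp rotations_left)
    show ?thesis
    proof (cases "R = \<langle>C, (), D\<rangle>")
      case True
      with rots show ?thesis by (auto intro!: detour_via_root simp: Node_neq_son)
    next
      case False
      have "rotations \<langle>L, (), \<langle>C, (), D\<rangle>\<rangle> Q"
        using rots by (meson converse_rtranclp_into_rtranclp at_root)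
      then show ?thesis
        using detour_via_right[OF R False] left_rotation_neq[OF in_left.hyps] by blast
    qed
  next
    case (2 L'')
    then show ?thesis
      using in_left.IH[OF 2(2) in_left.prems(2)] by (blast intro: detour_left somewhere.left)
  next
    case (3 R')
    then show ?thesis
      unfolding 3(1) using in_left.prems(2) in_left.hyps
      by (intro disjI1 detour_via_right[where R' = R'])
       (auto intro: somewhere_climb_rotations left_rotation.in_left dest: left_rotation_neq simp: somewhere_climb_neq)
  qed
next
  case (in_right R R' L)
  from in_right.prems(1) show ?case
  proof (cases rule: somewhere_NodeE)
    case 1
    then obtain k C D where m: "m = Suc k" and Q: "Q = \<langle>\<langle>L, (), C\<rangle>, (), D\<rangle>"
      and R': "climb k R' \<langle>C, (), D\<rangle>"
      using in_right.prems(2) by (auto elim: climb_NodeE)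
    from rotation_then_climb_root[OF in_right.hyps R'] show ?thesis
    proof (elim disjE exE conjE)
      assume "climb (Suc k) R \<langle>C, (), D\<rangle>"
      then show ?thesis unfolding m Q by (auto intro: here climb_Suc)
    next
      assume "detour R R' \<langle>C, (), D\<rangle>"
      then show ?thesis unfolding Q using detour_right detour_mono at_root by blast
    next
      fix C' D' assume R: "R = \<langle>C', (), D'\<rangle>" "rotations C' C" "rotations D' D"
      then show ?thesis
        unfolding R(1) Q by (intro disjI1 detour_via_root rotations_sons) (auto simp: Node_neq_son)
    qed
  next
    case (2 L')
    then show ?thesis
      unfolding 2(1) using in_right.prems(2) in_right.hyps
      by (intro disjI1 detour_via_left[where L' = L'])
       (auto intro: somewhere_climb_rotations left_rotation.in_right dest: left_rotation_neq simp: somewhere_climb_neq)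
  next
    case (3 R'')
    then show ?thesis
      using in_right.IH[OF 3(2) in_right.prems(2)] by (blast intro: detour_right somewhere.right)
  qed
qed

theorem linear_interval_iff:
  assumes "0 < k"
  shows "linear_interval P Q \<and> (left_rotation ^^ k) P Q \<longleftrightarrow> somewhere (slide k) P Q \<or> somewhere (climb k) P Q"
proof
  assume "somewhere (slide k) P Q \<or> somewhere (climb k) P Q"
  then show "linear_interval P Q \<and> (left_rotation ^^ k) P Q"
    using linear_somewhere_slide linear_somewhere_climb somewhere_slide_relpowp somewhere_climb_relpowp
    by blast
next
  assume "linear_interval P Q \<and> (left_rotation ^^ k) P Q"
  then show "somewhere (slide k) P Q \<or> somewhere (climb k) P Q"
    using assms
  proof (induction k arbitrary: P)
    case (Suc k)
    then obtain P\<^sub>1 where P\<^sub>1: "left_rotation P P\<^sub>1" "(left_rotation ^^ k) P\<^sub>1 Q"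
      by (meson relpowp_Suc_E2)
    show ?case
    proof (cases "k = 0")
      case True
      with P\<^sub>1 show ?thesis using somewhere_slide_1_iff by auto
    next
      case False
      have rots: "rotations P\<^sub>1 Q" using P\<^sub>1(2) by (rule relpowp_imp_rtranclp)
      have "linear_interval P\<^sub>1 Q" using Suc.prems P\<^sub>1(1) rots linear_subinterval by blast
      with Suc.IH[of P\<^sub>1] False P\<^sub>1 have "somewhere (slide k) P\<^sub>1 Q \<or> somewhere (climb k) P\<^sub>1 Q" by simp
      moreover have "\<not> detour P P\<^sub>1 Q" using linear_no_detour Suc.prems P\<^sub>1(1) rots by blast
      ultimately show ?thesis
        using rotation_then_slide[OF P\<^sub>1(1), of k Q] rotation_then_climb[OF P\<^sub>1(1), of k Q] False
        by (auto simp: numeral_2_eq_2)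
    qed
  qed simp
qed

section \<open>Counting lists of trees\<close>

text \<open>The number of nodes in a list of trees.\<close>

definition total_size :: "bin_tree list \<Rightarrow> nat" where
  "total_size ts = sum_list (map size ts)"

text \<open>
  The objects \<open>c\<close> of weight \<open>w c\<close> together with \<open>r\<close> trees, of total size \<open>m\<close>. The object is a
  context in one application and trivial in the other.
\<close>

definition pieces :: "('c \<Rightarrow> nat) \<Rightarrow> nat \<Rightarrow> nat \<Rightarrow> ('c \<times> bin_tree list) set" where
  "pieces w r m = {(c, ts). length ts = r \<and> w c + total_size ts = m}"

text \<open>
  The first of at least one tree is a leaf, or the two sons of its root replace it. The inverse
  operations put a leaf in front of the list and join the first two trees.
\<close>

definition leaf_front :: "'c \<times> bin_tree list \<Rightarrow> 'c \<times> bin_tree list" where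
  "leaf_front = (\<lambda>(c, ts). (c, \<langle>\<rangle> # ts))"

definition join_front :: "'c \<times> bin_tree list \<Rightarrow> 'c \<times> bin_tree list" where
  "join_front = (\<lambda>(c, ts). (c, \<langle>ts ! 0, (), ts ! 1\<rangle> # drop 2 ts))"

lemma pieces_Suc_SucE:
  assumes "x \<in> pieces w (Suc (Suc r)) m"
  obtains c L R ts where "x = (c, L # R # ts)" "length ts = r"
    "w c + size L + size R + total_size ts = m"
proof -
  obtain c us where x: "x = (c, us)" "length us = Suc (Suc r)" "w c + total_size us = m"
    using assms by (auto simp: pieces_def)
  then obtain L R ts where "us = L # R # ts" by (metis length_Suc_conv)
  with x show ?thesis by (intro that[of c L R ts]) (auto simp: total_size_def)
qed

lemma pieces_Suc:
  "pieces w (Suc r) m =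
    leaf_front ` pieces w r m \<union>
    (if m = 0 then {} else
      join_front ` pieces w (Suc (Suc r)) (m - 1))"
  (is "_ = ?A \<union> ?B")
proof (intro equalityI subsetI)
  fix x assume x: "x \<in> pieces w (Suc r) m"
  then obtain c t ts where c: "x = (c, t # ts)" "length ts = r" "w c + size t + total_size ts = m"
    by (auto simp: pieces_def length_Suc_conv total_size_def)
  show "x \<in> ?A \<union> ?B"
  proof (cases t)
    case Leaf
    with c have "x = leaf_front (c, ts)" "(c, ts) \<in> pieces w r m"
      by (auto simp: pieces_def leaf_front_def)
    then show ?thesis by blast
  next
    case (Node L u R)
    have "x = join_front (c, L # R # ts)"
      using c Node by (simp add: join_front_def)
    moreover have "(c, L # R # ts) \<in> pieces w (Suc (Suc r)) (m - 1)" "m \<noteq> 0"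
      using c Node by (auto simp: pieces_def total_size_def)
    ultimately have "m \<noteq> 0" "x \<in> join_front ` pieces w (Suc (Suc r)) (m - 1)" by blast+
    then show ?thesis by simp
  qed
next
  fix x assume "x \<in> ?A \<union> ?B"
  then show "x \<in> pieces w (Suc r) m"
  proof
    assume "x \<in> ?B"
    then obtain y where m: "m \<noteq> 0" and y: "x = join_front y" "y \<in> pieces w (Suc (Suc r)) (m - 1)"
      by (auto split: if_splits)
    from y(2) show ?thesis
      by (rule pieces_Suc_SucE) (use m y(1) in \<open>simp add: pieces_def join_front_def total_size_def\<close>)
  qed (auto simp: pieces_def leaf_front_def total_size_def)
qed

lemma pieces_disjoint: "leaf_front ` X \<inter> join_front ` Y = {}"
  by (auto simp: leaf_front_def join_front_def)

lemma pieces_inj: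
  "inj_on leaf_front X"
  "inj_on join_front (pieces w (Suc (Suc r)) m)"
proof -
  show "inj_on leaf_front X" by (auto simp: inj_on_def leaf_front_def)
  show "inj_on join_front (pieces w (Suc (Suc r)) m)"
  proof (rule inj_onI)
    fix x y
    assume x: "x \<in> pieces w (Suc (Suc r)) m" and y: "y \<in> pieces w (Suc (Suc r)) m"
      and eq: "join_front x = join_front y"
    obtain c L R ts where "x = (c, L # R # ts)" using x by (rule pieces_Suc_SucE)
    moreover obtain c' L' R' ts' where "y = (c', L' # R' # ts')" using y by (rule pieces_Suc_SucE)
    ultimately show "x = y" using eq by (simp add: join_front_def)
  qed
qed

lemma finite_pieces:
  assumes "\<And>m. finite (pieces w 0 m)"
  shows "finite (pieces w r m)"
proof (induction m arbitrary: r)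
  case 0
  show ?case
  proof (induction r)
    case (Suc r)
    then show ?case by (subst pieces_Suc) simp
  qed (rule assms)
next
  case (Suc m)
  note IH = Suc
  show ?case
  proof (induction r)
    case (Suc r)
    then show ?case using IH by (subst pieces_Suc) simp
  qed (rule assms)
qed

lemma card_pieces_Suc_0: "card (pieces w (Suc r) 0) = card (pieces w r 0)"
  by (simp add: pieces_Suc card_image pieces_inj)

lemma card_pieces_Suc_Suc:
  assumes "\<And>m. finite (pieces w 0 m)"
  shows "card (pieces w (Suc r) (Suc m)) = card (pieces w r (Suc m)) + card (pieces w (Suc (Suc r)) m)"
  by (subst pieces_Suc)
    (simp add: card_Un_disjoint card_image pieces_inj finite_pieces assms pieces_disjoint)

text \<open>Lists of \<open>r\<close> trees of total size \<open>m\<close>; the first component carries no information.\<close>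

definition forests :: "nat \<Rightarrow> nat \<Rightarrow> (unit \<times> bin_tree list) set" where
  "forests = pieces (\<lambda>_. 0)"

lemma forests_0: "forests 0 m = (if m = 0 then {((), [])} else {})"
  by (auto simp: forests_def pieces_def total_size_def)

lemma card_forests_0: "card (forests r 0) = 1"
proof (induction r)
  case (Suc r)
  then show ?case by (simp add: forests_def card_pieces_Suc_0)
qed (simp add: forests_0)

text \<open>
  The ballot numbers \<open>(2m + r - 1 choose m) - (2m + r - 1 choose (m - 1))\<close>, with \<open>Suc m\<close> in place
  of \<open>m\<close> and the difference written as a sum.
\<close>

lemma card_forests:
  "card (forests r (Suc m)) + (2 * m + r + 1 choose m) = (2 * m + r + 1 choose Suc m)"
proof (induction m arbitrary: r)
  case 0
  show ?case
  proof (induction r)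
    case (Suc r)
    have "card (forests (Suc r) (Suc 0)) = card (forests r (Suc 0)) + 1"
      using card_forests_0[of "Suc (Suc r)"] forests_0
      unfolding forests_def by (subst card_pieces_Suc_Suc) (auto simp: forests_def[symmetric])
    with Suc show ?case by simp
  qed (simp add: forests_0)
next
  case (Suc m)
  note IH = Suc
  show ?case
  proof (induction r)
    case 0
    have "(2 * Suc m + 1 choose Suc m) = (2 * Suc m + 1 choose Suc (Suc m))"
      by (subst binomial_symmetric) (auto)
    then show ?case by (simp add: forests_0)
  next
    case (Suc r)
    have "card (forests (Suc r) (Suc (Suc m))) = card (forests r (Suc (Suc m))) + card (forests (Suc (Suc r)) (Suc m))"
      unfolding forests_def by (subst card_pieces_Suc_Suc) (auto simp: forests_def[symmetric] forests_0)
    moreover have "(2 * Suc m + Suc r + 1 choose Suc m) = (2 * Suc m + r + 1 choose Suc m) + (2 * m + Suc (Suc r) + 1 choose m)"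
      "(2 * Suc m + Suc r + 1 choose Suc (Suc m)) = (2 * Suc m + r + 1 choose Suc (Suc m)) + (2 * m + Suc (Suc r) + 1 choose Suc m)"
      by (simp_all add: numeral_2_eq_2)
    ultimately show ?case using Suc IH[of "Suc (Suc r)"] by simp
  qed
qed

lemma card_Tam_forests: "card (Tam n) = card (forests 1 n)"
proof -
  have "forests 1 n = (\<lambda>t. ((), [t])) ` Tam n"
    by (auto simp: forests_def pieces_def Tam_def total_size_def length_Suc_conv)
  moreover have "inj_on (\<lambda>t. ((), [t])) (Tam n)" by (auto simp: inj_on_def)
  ultimately show ?thesis by (simp add: card_image)
qed

lemma card_Tam: "(n + 1) * card (Tam n) = (2 * n choose n)"
proof (cases n)
  case 0
  then show ?thesis using card_forests_0[of 1] by (simp add: card_Tam_forests)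
next
  case (Suc m)
  have "card (Tam n) + (2 * n choose m) = (2 * n choose n)"
    using card_forests[of 1 m] Suc by (simp add: card_Tam_forests)
  moreover have "(n + 1) * (2 * n choose m) = n * (2 * n choose n)"
  proof -
    have "2 * n - m = n + 1" using Suc by simp
    then show ?thesis
      using binomial_absorb_comp[of "2 * n" m] binomial_absorption[of m "2 * n"] Suc by metis
  qed
  ultimately have "(n + 1) * card (Tam n) + n * (2 * n choose n) = (n + 1) * (2 * n choose n)"
    by (metis add_mult_distrib2)
  then show ?thesis by simp
qed

section \<open>Counting slides\<close>

text \<open>
  A tree with a hole, listed from the root to the hole. An entry \<open>(True, S)\<close> says that the hole is
  in the left subtree and that \<open>S\<close> is the right subtree, \<open>(False, S)\<close> the converse.
\<close>

type_synonym tree_context = "(bool \<times> bin_tree) list"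

fun plug :: "tree_context \<Rightarrow> bin_tree \<Rightarrow> bin_tree" where
  "plug [] t = t"
| "plug ((True, S) # c) t = \<langle>plug c t, (), S\<rangle>"
| "plug ((False, S) # c) t = \<langle>S, (), plug c t\<rangle>"

definition context_size :: "tree_context \<Rightarrow> nat" where
  "context_size c = (\<Sum>(b, S)\<leftarrow>c. Suc (size S))"

lemma size_plug: "size (plug c t) = context_size c + size t"
  by (induction c t rule: plug.induct) (auto simp: context_size_def)

lemma somewhere_iff_plug: "somewhere r P Q \<longleftrightarrow> (\<exists>c P' Q'. r P' Q' \<and> P = plug c P' \<and> Q = plug c Q')"
proof
  assume "somewhere r P Q"
  then show "\<exists>c P' Q'. r P' Q' \<and> P = plug c P' \<and> Q = plug c Q'"
  proof (induction rule: somewhere.induct)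
    case (here P Q)
    then show ?case by (metis plug.simps(1))
  next
    case (left L L' R)
    then show ?case by (metis plug.simps(2))
  next
    case (right R R' L)
    then show ?case by (metis plug.simps(3))
  qed
next
  have "somewhere r (plug c P) (plug c Q)" if "r P Q" for c P Q
    using that by (induction c P rule: plug.induct) (auto intro: somewhere.intros)
  then show "\<exists>c P' Q'. r P' Q' \<and> P = plug c P' \<and> Q = plug c Q' \<Longrightarrow> somewhere r P Q" by blast
qed

text \<open>The tree with \<open>C\<close> at the end of its left branch and right subtrees \<open>Ds\<close>, from the root down.\<close>

fun left_comb :: "bin_tree \<Rightarrow> bin_tree list \<Rightarrow> bin_tree" where
  "left_comb C [] = C"
| "left_comb C (D # Ds) = \<langle>left_comb C Ds, (), D\<rangle>"

lemma size_left_comb: "size (left_comb C Ds) = size C + length Ds + total_size Ds"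
  by (induction Ds) (auto simp: total_size_def)

lemma slide_iff_left_comb:
  "slide k P Q \<longleftrightarrow>
    (\<exists>B C Ds. length Ds = k \<and> P = \<langle>B, (), left_comb C Ds\<rangle> \<and> Q = left_comb \<langle>B, (), C\<rangle> Ds)"
proof
  assume "slide k P Q"
  then show "\<exists>B C Ds. length Ds = k \<and> P = \<langle>B, (), left_comb C Ds\<rangle> \<and> Q = left_comb \<langle>B, (), C\<rangle> Ds"
  proof (induction rule: slide.induct)
    case (slide_Suc k B X Y D)
    then obtain C Ds where "length Ds = k" "X = left_comb C Ds" "Y = left_comb \<langle>B, (), C\<rangle> Ds"
      by auto
    then show ?case by (intro exI[of _ B] exI[of _ C] exI[of _ "D # Ds"]) auto
  qed auto
next
  have "slide (length Ds) \<langle>B, (), left_comb C Ds\<rangle> (left_comb \<langle>B, (), C\<rangle> Ds)" for B C Ds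
    by (induction Ds) (auto intro: slide.intros)
  then show "\<exists>B C Ds. length Ds = k \<and> P = \<langle>B, (), left_comb C Ds\<rangle> \<and> Q = left_comb \<langle>B, (), C\<rangle> Ds
    \<Longrightarrow> slide k P Q" by auto
qed

lemma left_comb_inj:
  "left_comb C Ds = left_comb C' Ds' \<Longrightarrow> length Ds = length Ds' \<Longrightarrow> C = C' \<and> Ds = Ds'"
  by (induction Ds Ds' arbitrary: C C' rule: list_induct2') auto

text \<open>Bottom and top of the interval with context \<open>c\<close> and subtrees \<open>B # C # Ds\<close>.\<close>

definition slide_pair :: "tree_context \<times> bin_tree list \<Rightarrow> bin_tree \<times> bin_tree" where
  "slide_pair = (\<lambda>(c, ts). (plug c \<langle>ts ! 0, (), left_comb (ts ! 1) (drop 2 ts)\<rangle>,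
     plug c (left_comb \<langle>ts ! 0, (), ts ! 1\<rangle> (drop 2 ts))))"

text \<open>The endpoints of the intervals of the first shape on trees of size \<open>n\<close>.\<close>

definition slide_pairs :: "nat \<Rightarrow> nat \<Rightarrow> (bin_tree \<times> bin_tree) set" where
  "slide_pairs n k = {(P, Q). size P = n \<and> somewhere (slide k) P Q}"

lemma slide_pairs_eq_image:
  assumes "k < n"
  shows "slide_pairs n k = slide_pair ` pieces context_size (k + 2) (n - k - 1)"
proof (intro equalityI subsetI)
  fix x assume "x \<in> slide_pairs n k"
  then obtain c B C Ds where x: "x = slide_pair (c, B # C # Ds)" "length Ds = k"
    and n: "size (plug c \<langle>B, (), left_comb C Ds\<rangle>) = n"
    by (auto simp: slide_pairs_def somewhere_iff_plug slide_iff_left_comb) (fastforce simp: slide_pair_def)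
  then have "(c, B # C # Ds) \<in> pieces context_size (k + 2) (n - k - 1)"
    by (auto simp: pieces_def size_plug size_left_comb total_size_def)
  with x show "x \<in> slide_pair ` pieces context_size (k + 2) (n - k - 1)" by blast
next
  fix x assume "x \<in> slide_pair ` pieces context_size (k + 2) (n - k - 1)"
  then obtain c B C Ds where x: "x = slide_pair (c, B # C # Ds)" "length Ds = k"
    and "context_size c + total_size (B # C # Ds) = n - k - 1"
    by (auto simp: pieces_def length_Suc_conv numeral_2_eq_2)
  with assms have "size (plug c \<langle>B, (), left_comb C Ds\<rangle>) = n"
    by (auto simp: size_plug size_left_comb total_size_def)
  with x show "x \<in> slide_pairs n k"
    by (simp add: slide_pairs_def somewhere_iff_plug slide_iff_left_comb slide_pair_def) blast
qed

lemma size_left_comb_left: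
  assumes "left_comb \<langle>B, (), C\<rangle> Ds = \<langle>L, (), R\<rangle>" "Ds \<noteq> []"
  shows "size B < size L" "size R < size (left_comb C Ds)"
  using assms by (cases Ds; force simp: size_left_comb)+

text \<open>
  A slide of positive length changes both subtrees of its root, whereas a nonempty context keeps
  one of them, so the pair determines the context.
\<close>

lemma plug_left_comb_inj:
  assumes "plug c \<langle>B, (), left_comb C Ds\<rangle> = plug c' \<langle>B', (), left_comb C' Ds'\<rangle>"
    and "plug c (left_comb \<langle>B, (), C\<rangle> Ds) = plug c' (left_comb \<langle>B', (), C'\<rangle> Ds')"
    and len: "length Ds = length Ds'" "Ds \<noteq> []"
  shows "c = c' \<and> B = B' \<and> C = C' \<and> Ds = Ds'"
proof -
  have neq: "plug c \<langle>B, (), left_comb C Ds\<rangle> \<noteq> plug c (left_comb \<langle>B, (), C\<rangle> Ds)"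
    if "Ds \<noteq> []" for c B C Ds
    using that
  proof (induction c)
    case Nil
    then show ?case using size_left_comb_left(1)[of B C Ds B "left_comb C Ds"] by auto
  next
    case (Cons a c)
    then show ?case by (cases a; cases "fst a") auto
  qed
  have nil: False
    if "\<langle>B, (), left_comb C Ds\<rangle> = plug (a # c') \<langle>B', (), left_comb C' Ds'\<rangle>"
      "left_comb \<langle>B, (), C\<rangle> Ds = plug (a # c') (left_comb \<langle>B', (), C'\<rangle> Ds')" "Ds \<noteq> []"
    for B C Ds a c' B' C' Ds'
    using that size_left_comb_left[of B C Ds] by (cases a; cases "fst a") force+
  show ?thesis
    using assms(1,2)
  proof (induction c arbitrary: c')
    case Nil
    show ?case
    proof (cases c')
      case Nil
      with Nil.prems have "B = B'" "left_comb C Ds = left_comb C' Ds'" by simp_all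
      with Nil len show ?thesis using left_comb_inj[of C Ds C' Ds'] by simp
    next
      case (Cons a d)
      with Nil.prems len show ?thesis using nil[of B C Ds a d B' C' Ds'] by simp
    qed
  next
    case (Cons a c)
    show ?case
    proof (cases c')
      case Nil
      then show ?thesis
        using Cons.prems len nil[of B' C' Ds' a c B C Ds] by (metis length_0_conv plug.simps(1))
    next
      case c': (Cons a' d)
      obtain b S b' S' where a: "a = (b, S)" "a' = (b', S')" by (cases a; cases a')
      show ?thesis
      proof (cases "b = b'")
        case True
        then show ?thesis using Cons.prems Cons.IH[of d] unfolding c' a by (cases b) auto
      next
        case False
        then show ?thesis using Cons.prems neq[OF len(2), of c B C] unfolding c' a
          by (cases b; cases b') auto
      qed
    qed
  qed
qed

lemma inj_on_slide_pair:
  assumes "0 < k"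
  shows "inj_on slide_pair (pieces context_size (k + 2) m)"
proof (rule inj_onI)
  fix x y assume x: "x \<in> pieces context_size (k + 2) m" and y: "y \<in> pieces context_size (k + 2) m"
    and eq: "slide_pair x = slide_pair y"
  obtain c B C Ds where x': "x = (c, B # C # Ds)" "length Ds = k"
    using x unfolding add_2_eq_Suc' by (rule pieces_Suc_SucE)
  obtain c' B' C' Ds' where y': "y = (c', B' # C' # Ds')" "length Ds' = k"
    using y unfolding add_2_eq_Suc' by (rule pieces_Suc_SucE)
  show "x = y"
    using eq plug_left_comb_inj[of c B C Ds c' B' C' Ds'] x' y' assms by (auto simp: slide_pair_def)
qed

lemma finite_contexts: "finite (pieces context_size r m)"
  and card_contexts: "card (pieces context_size r m) = (2 * m + r choose m)"
proof -
  have zero: "pieces context_size 0 0 = {([], [])}"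
  proof -
    have empty: "context_size c = 0 \<longleftrightarrow> c = []" for c
      by (cases c) (auto simp: context_size_def)
    show ?thesis by (auto simp: pieces_def total_size_def empty)
  qed
  have pieces_0_Suc: "pieces context_size 0 (Suc m) =
    (\<lambda>(c, ts). ((True, ts ! 0) # c, [])) ` pieces context_size 1 m \<union>
    (\<lambda>(c, ts). ((False, ts ! 0) # c, [])) ` pieces context_size 1 m" (is "_ = ?T \<union> ?F") for m
  proof (intro equalityI subsetI)
    fix x assume "x \<in> pieces context_size 0 (Suc m)"
    then obtain d where d: "x = (d, [])" "context_size d = Suc m"
      by (auto simp: pieces_def total_size_def)
    then obtain b S c where c: "d = (b, S) # c"
      by (cases d) (auto simp: context_size_def)
    with d have mem: "(c, [S]) \<in> pieces context_size 1 m"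
      by (auto simp: pieces_def total_size_def context_size_def)
    show "x \<in> ?T \<union> ?F"
    proof (cases b)
      case True
      with d c mem have "x \<in> ?T" by (intro image_eqI[OF _ mem]) simp
      then show ?thesis ..
    next
      case False
      with d c mem have "x \<in> ?F" by (intro image_eqI[OF _ mem]) simp
      then show ?thesis ..
    qed
  next
    fix x assume "x \<in> ?T \<union> ?F"
    then obtain b c ts where x: "x = ((b, ts ! 0) # c, [])" "(c, ts) \<in> pieces context_size 1 m"
      by auto
    then have "length ts = 1" "context_size c + total_size ts = m" by (auto simp: pieces_def)
    then show "x \<in> pieces context_size 0 (Suc m)"
      unfolding x(1) by (cases ts) (auto simp: pieces_def total_size_def context_size_def)
  qed
  have disj: "(\<lambda>(c, ts). ((True, ts ! 0) # c, [])) ` X \<inter> (\<lambda>(c, ts). ((False, ts ! 0) # c, [] :: bin_tree list)) ` Y = {}"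
    for X Y :: "(tree_context \<times> bin_tree list) set" by auto
  have inj: "inj_on (\<lambda>(c, ts). ((b, ts ! 0) # c, [] :: bin_tree list)) (pieces context_size 1 m)" for b m
    by (auto simp: inj_on_def pieces_def intro!: nth_equalityI)
  have fin: "finite (pieces context_size r m)" for r m
  proof (induction m arbitrary: r)
    case 0
    show ?case
    proof (induction r)
      case (Suc r)
      then show ?case by (subst pieces_Suc) simp
    qed (simp add: zero)
  next
    case (Suc m)
    note IH = Suc
    show ?case
    proof (induction r)
      case 0
      then show ?case unfolding pieces_0_Suc using IH by simp
    next
      case (Suc r)
      then show ?case using IH by (subst pieces_Suc) simp
    qed
  qed
  show "finite (pieces context_size r m)" by (rule fin)
  have card0: "card (pieces context_size 0 (Suc m)) = 2 * card (pieces context_size 1 m)" for m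
    unfolding pieces_0_Suc by (subst card_Un_disjoint) 
      (use card_image[OF inj[of True m]] card_image[OF inj[of False m]] in \<open>auto simp: fin disj\<close>)
  show "card (pieces context_size r m) = (2 * m + r choose m)"
  proof (induction m arbitrary: r)
    case 0
    show ?case by (induction r) (auto simp: card_pieces_Suc_0 zero)
  next
    case (Suc m)
    note IH = Suc
    show ?case
    proof (induction r)
      case 0
      have "(2 * m + 1 choose m) = (2 * m + 1 choose Suc m)"
        by (subst binomial_symmetric) auto
      then show ?case using IH[of 1] by (simp add: card0)
    next
      case (Suc r)
      have "(2 * Suc m + Suc r choose Suc m) = (2 * Suc m + r choose Suc m) + (2 * m + Suc (Suc r) choose m)"
        by (simp add: numeral_2_eq_2)
      then show ?case using Suc IH[of "Suc (Suc r)"] by (simp add: card_pieces_Suc_Suc fin)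
    qed
  qed
qed

lemma finite_slide_pairs: "k < n \<Longrightarrow> finite (slide_pairs n k)"
  by (simp add: slide_pairs_eq_image finite_contexts)

lemma card_slide_pairs:
  assumes "0 < k" "k < n"
  shows "card (slide_pairs n k) = (2 * n - k choose (n - k - 1))"
proof -
  have "card (slide_pairs n k) = (2 * (n - k - 1) + (k + 2) choose (n - k - 1))"
    unfolding slide_pairs_eq_image[OF assms(2)]
    by (simp only: card_image[OF inj_on_slide_pair[OF assms(1)]] card_contexts)
  also have "2 * (n - k - 1) + (k + 2) = 2 * n - k" using assms by simp
  finally show ?thesis .
qed

lemma slide_pairs_empty: "n \<le> k \<Longrightarrow> slide_pairs n k = {}"
  by (auto simp: slide_pairs_def somewhere_iff_plug slide_iff_left_comb size_plug size_left_comb)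

section \<open>Intervals of the Tamari lattice\<close>

lemma in_tamari_order_iff: "(P, Q) \<in> tamari_order n \<longleftrightarrow> size P = n \<and> rotations P Q"
  by (auto simp: tamari_order_def Tam_def dest: left_rotations_size)

lemma mem_interval_iff:
  assumes "size P = n"
  shows "R \<in> interval (tamari_order n) P Q \<longleftrightarrow> rotations P R \<and> rotations R Q"
  using assms by (auto simp: interval_def in_tamari_order_iff dest: left_rotations_size)

lemma linear_iff_total_on:
  "(P, Q) \<in> tamari_order n \<and> total_on (interval (tamari_order n) P Q) (tamari_order n)
    \<longleftrightarrow> size P = n \<and> linear_interval P Q"
proof (cases "size P = n")
  case True
  have size: "size R = n" if "rotations P R" for R using True that left_rotations_size by metis
  show ?thesis
  proof (intro iffI conjI; (elim conjE)?)
    assume order: "(P, Q) \<in> tamari_order n"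
      and total: "total_on (interval (tamari_order n) P Q) (tamari_order n)"
    have "rotations R S \<or> rotations S R"
      if "rotations P R" "rotations R Q" "rotations P S" "rotations S Q" for R S
    proof (cases "R = S")
      case False
      have "R \<in> interval (tamari_order n) P Q" "S \<in> interval (tamari_order n) P Q"
        using that by (simp_all add: mem_interval_iff[OF True])
      with total False have "(R, S) \<in> tamari_order n \<or> (S, R) \<in> tamari_order n"
        by (simp add: total_on_def)
      then show ?thesis by (auto simp: in_tamari_order_iff)
    qed simp
    with order show "linear_interval P Q" by (simp add: linear_interval_def in_tamari_order_iff)
  next
    assume "linear_interval P Q"
    then show "(P, Q) \<in> tamari_order n"
      and "total_on (interval (tamari_order n) P Q) (tamari_order n)"
      by (auto simp: linear_interval_def total_on_def mem_interval_iff[OF True] in_tamari_order_iff True size)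
  qed (rule True)
qed (simp add: in_tamari_order_iff)

lemma interval_inject:
  assumes "(P, Q) \<in> tamari_order n" "(P', Q') \<in> tamari_order n"
    and "interval (tamari_order n) P Q = interval (tamari_order n) P' Q'"
  shows "P = P' \<and> Q = Q'"
proof -
  have n: "size P = n" "size P' = n" and rots: "rotations P Q" "rotations P' Q'"
    using assms(1,2) by (auto simp: in_tamari_order_iff)
  have "R \<in> interval (tamari_order n) P Q \<longleftrightarrow> R \<in> interval (tamari_order n) P' Q'" for R
    using assms(3) by simp
  then have "rotations P R \<and> rotations R Q \<longleftrightarrow> rotations P' R \<and> rotations R Q'" for R
    by (simp add: mem_interval_iff n)
  with rots show ?thesis by (meson rotations_antisym rtranclp.rtrancl_refl)
qed

text \<open>
  Any chain of rotations between the endpoints of a linear interval contains all of its elements,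
  so its length is the height.
\<close>

lemma interval_height_eq:
  assumes lin: "linear_interval P Q" and k: "(left_rotation ^^ k) P Q" and n: "size P = n"
  shows "interval_height (tamari_order n) P Q = k"
proof -
  obtain f where f: "f 0 = P" "f k = Q" "\<And>i. i < k \<Longrightarrow> left_rotation (f i) (f (Suc i))"
    using k by (auto simp: relpowp_fun_conv)
  have f_mono: "rotations (f i) (f j)" if "i \<le> j" "j \<le> k" for i j
    using that
  proof (induction rule: dec_induct)
    case (step j)
    then show ?case using f(3)[of j] by (simp add: rtranclp.rtrancl_into_rtrancl)
  qed simp
  have between: "R \<in> f ` {..k}" if "i \<le> k" "rotations (f i) R" "rotations R Q" for i R
    using that
  proof (induction rule: inc_induct)
    case base
    then show ?case using f(2) rotations_antisym by blast
  next
    case (step i)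
    show ?case
    proof (cases "rotations (f (Suc i)) R")
      case True
      with step show ?thesis by blast
    next
      case False
      have "rotations P (f i)" "rotations P (f (Suc i))" "rotations (f (Suc i)) Q"
        using f_mono[of 0 i] f_mono[of 0 "Suc i"] f_mono[of "Suc i" k] f(1,2) step.hyps by auto
      with False step.prems lin have R: "rotations R (f (Suc i))"
        unfolding linear_interval_def by (meson rtranclp_trans)
      from step.prems(1) show ?thesis
      proof (cases rule: converse_rtranclpE)
        case base
        with step.hyps show ?thesis by auto
      next
        case (step T)
        with R have "rotations T (f (Suc i))" by simp
        then have "T = f (Suc i)"
          using left_rotations_incomparable[OF step(1) f(3)] \<open>i < k\<close> by blast
        with step False show ?thesis by simp
      qed
    qed
  qed
  let ?K = "{k. \<exists>c :: nat \<Rightarrow> bin_tree. c 0 = P \<and> c k = Q \<and>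
     (\<forall>i<k. (c i, c (Suc i)) \<in> tamari_order n \<and> c i \<noteq> c (Suc i))}"
  have "k \<in> ?K"
  proof -
    have "size (f i) = n" if "i \<le> k" for i
      using left_rotations_size[OF f_mono[of 0 i]] that f(1) n by simp
    with f show ?thesis
      by (auto simp: in_tamari_order_iff intro!: exI[of _ f] dest: left_rotation_neq)
  qed
  moreover have "m \<le> k" if m: "m \<in> ?K" for m
  proof -
    obtain c where c: "c 0 = P" "c m = Q"
      "\<And>i. i < m \<Longrightarrow> rotations (c i) (c (Suc i)) \<and> c i \<noteq> c (Suc i)"
      using m by (auto simp: in_tamari_order_iff)
    have c_mono: "rotations (c i) (c j)" if "i \<le> j" "j \<le> m" for i j
      using that
    proof (induction rule: dec_induct)
      case (step j)
      then show ?case using c(3)[of j] by (auto intro: rtranclp_trans)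
    qed simp
    have c_strict: "left_weight (c i) < left_weight (c j)" if "i < j" "j \<le> m" for i j
    proof -
      have "left_weight (c i) < left_weight (c (Suc i))"
        using c(3)[of i] that left_rotations_left_weight by fastforce
      also have "\<dots> \<le> left_weight (c j)"
        using left_rotations_left_weight[OF c_mono[of "Suc i" j]] that by auto
      finally show ?thesis .
    qed
    have "inj_on c {..m}"
      by (rule linorder_inj_onI) (use c_strict in fastforce)+
    moreover have "c ` {..m} \<subseteq> f ` {..k}"
      using between[of 0] c_mono[of 0] c_mono[of _ m] c(1,2) f(1) by auto
    ultimately have "card {..m} \<le> card (f ` {..k})"
      by (intro card_inj_on_le) auto
    also have "\<dots> \<le> card {..k}" by (rule card_image_le) simp
    finally show ?thesis by simp
  qed
  ultimately show ?thesis
    unfolding interval_height_def by (intro Max_eqI) (auto intro: finite_subset[of _ "{..k}"])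
qed

text \<open>The endpoints of the linear intervals of height \<open>k\<close>.\<close>

definition linear_pairs :: "nat \<Rightarrow> nat \<Rightarrow> (bin_tree \<times> bin_tree) set" where
  "linear_pairs n k = {(P, Q). size P = n \<and> linear_interval P Q \<and> (left_rotation ^^ k) P Q}"

lemma linear_imp_relpowp: "linear_interval P Q \<Longrightarrow> \<exists>k. (left_rotation ^^ k) P Q"
  unfolding linear_interval_def by (simp add: rtranclp_power)

lemma linear_intervals_of_height_eq_image:
  "linear_intervals_of_height (tamari_order n) k =
    (\<lambda>(P, Q). interval (tamari_order n) P Q) ` linear_pairs n k"
proof -
  have "(P, Q) \<in> tamari_order n \<and> total_on (interval (tamari_order n) P Q) (tamari_order n) \<and>
      interval_height (tamari_order n) P Q = k \<longleftrightarrow> (P, Q) \<in> linear_pairs n k" for P Q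
  proof -
    have "interval_height (tamari_order n) P Q = k \<longleftrightarrow> (left_rotation ^^ k) P Q"
      if "size P = n" "linear_interval P Q"
      using that linear_imp_relpowp interval_height_eq by metis
    then show ?thesis using linear_iff_total_on[of P Q n] by (auto simp: linear_pairs_def)
  qed
  then show ?thesis unfolding linear_intervals_of_height_def by (auto simp: image_def)
qed

lemma linear_intervals_eq_image:
  "linear_intervals (tamari_order n) =
    (\<lambda>(P, Q). interval (tamari_order n) P Q) ` (\<Union>k. linear_pairs n k)"
proof -
  have "(P, Q) \<in> tamari_order n \<and> total_on (interval (tamari_order n) P Q) (tamari_order n)
      \<longleftrightarrow> (P, Q) \<in> (\<Union>k. linear_pairs n k)" for P Q
    using linear_iff_total_on[of P Q n] linear_imp_relpowp by (auto simp: linear_pairs_def)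
  then show ?thesis unfolding linear_intervals_def by (auto simp: image_def)
qed

lemma inj_on_interval_linear_pairs:
  "inj_on (\<lambda>(P, Q). interval (tamari_order n) P Q) (\<Union>k. linear_pairs n k)"
proof (rule inj_onI, clarify)
  fix P Q P' Q' j k
  assume "(P, Q) \<in> linear_pairs n j" "(P', Q') \<in> linear_pairs n k"
    and eq: "interval (tamari_order n) P Q = interval (tamari_order n) P' Q'"
  then have "(P, Q) \<in> tamari_order n" "(P', Q') \<in> tamari_order n"
    by (auto simp: linear_pairs_def linear_interval_def in_tamari_order_iff)
  from interval_inject[OF this eq] show "P = P' \<and> Q = Q'" .
qed

lemma card_linear_intervals_of_height:
  "card (linear_intervals_of_height (tamari_order n) k) = card (linear_pairs n k)"
  unfolding linear_intervals_of_height_eq_image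
  by (rule card_image[OF inj_on_subset[OF inj_on_interval_linear_pairs]]) blast

lemma finite_linear_pairs: "finite (linear_pairs n k)"
  by (rule finite_subset[OF _ finite_cartesian_product[OF finite_Tam[of n] finite_Tam[of n]]])
    (auto simp: linear_pairs_def linear_interval_def Tam_def dest: left_rotations_size)

lemma linear_pairs_disjoint: "j \<noteq> k \<Longrightarrow> linear_pairs n j \<inter> linear_pairs n k = {}"
  by (auto simp: linear_pairs_def dest: interval_height_eq)

section \<open>Cardinalities\<close>

text \<open>The endpoints of the intervals of the second shape.\<close>

definition climb_pairs :: "nat \<Rightarrow> nat \<Rightarrow> (bin_tree \<times> bin_tree) set" where
  "climb_pairs n k = {(P, Q). size P = n \<and> somewhere (climb k) P Q}"

lemma climb_pairs_eq_image: "climb_pairs n k = (\<lambda>(P, Q). (mirror Q, mirror P)) ` slide_pairs n k"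
proof -
  have size: "size P = size Q" if "somewhere (slide k) P Q" for P Q
    using left_rotations_size[OF somewhere_slide_rotations[OF that]] .
  show ?thesis
  proof (intro equalityI subsetI)
    fix x assume "x \<in> climb_pairs n k"
    then obtain P Q where x: "x = (P, Q)" "size P = n" "somewhere (slide k) (mirror Q) (mirror P)"
      by (auto simp: climb_pairs_def somewhere_climb_iff_mirror)
    with size[of "mirror Q" "mirror P"] have "(mirror Q, mirror P) \<in> slide_pairs n k"
      by (simp add: slide_pairs_def)
    then show "x \<in> (\<lambda>(P, Q). (mirror Q, mirror P)) ` slide_pairs n k"
      by (rule rev_image_eqI) (simp add: x)
  qed (auto simp: climb_pairs_def slide_pairs_def somewhere_climb_iff_mirror dest: size)
qed

lemma card_climb_pairs: "card (climb_pairs n k) = card (slide_pairs n k)"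
  unfolding climb_pairs_eq_image
proof (rule card_image, rule inj_onI, clarify)
  fix P Q P' Q' :: bin_tree assume "mirror Q = mirror Q'" "mirror P = mirror P'"
  then show "P = P' \<and> Q = Q'" by (metis mirror_mirror)
qed

lemma linear_pairs_eq: "0 < k \<Longrightarrow> linear_pairs n k = slide_pairs n k \<union> climb_pairs n k"
  using linear_interval_iff by (auto simp: linear_pairs_def slide_pairs_def climb_pairs_def)

lemma slide_climb_less_2:
  assumes "somewhere (slide k) P Q" "somewhere (climb k) P Q"
  shows "k < 2"
proof (cases "k = 0")
  case False
  have "k = 1" if "somewhere (slide k) P Q" "somewhere (climb k) P Q"
    using that
  proof (induction rule: somewhere.induct)
    case (here P Q)
    from here(1) False obtain B C D Y j where k: "k = Suc j" and P: "P = \<langle>B, (), \<langle>C, (), D\<rangle>\<rangle>"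
      and Q: "Q = \<langle>Y, (), D\<rangle>" and Y: "slide j \<langle>B, (), C\<rangle> Y"
      by (cases rule: slide.cases) auto
    have size: "size Y = size \<langle>B, (), C\<rangle>" using slide_size[OF Y] by simp
    from here(2)[unfolded P] show ?case
    proof (cases rule: somewhere_NodeE)
      case 1
      then obtain C' where Y': "Y = \<langle>B, (), C'\<rangle>"
        using Q False by (auto elim: climb_NodeE)
      from Y show ?thesis
      proof (cases rule: slide_NodeE)
        case (2 i C\<^sub>1 C\<^sub>2 Z)
        then have "slide i \<langle>B, (), C\<^sub>1\<rangle> B" using Y' by simp
        then show ?thesis using slide_size by fastforce
      qed (simp add: k)
    next
      case 2
      with Q show ?thesis by (simp add: Node_neq_son)
    next
      case 3
      with Q size show ?thesis by simp
    qed
  next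
    case (left L L' R)
    from left.prems show ?case
    proof (cases rule: somewhere_NodeE)
      case 1
      then obtain j C where "climb j R \<langle>C, (), R\<rangle>" using False by (auto elim: climb_NodeE)
      then show ?thesis using climb_size by fastforce
    next
      case (2 M)
      with left.IH show ?thesis by simp
    next
      case (3 M)
      with left.hyps False show ?thesis using somewhere_slide_neq by blast
    qed
  next
    case (right R R' L)
    from right.prems show ?case
    proof (cases rule: somewhere_NodeE)
      case 1
      then show ?thesis using False by (auto elim!: climb_NodeE simp: Node_neq_son)
    next
      case (2 M)
      with right.hyps False show ?thesis using somewhere_slide_neq by blast
    next
      case (3 M)
      with right.IH show ?thesis by simp
    qed
  qed
  with assms show ?thesis by simp
qed simp

lemma card_linear_pairs_0: "card (linear_pairs n 0) = card (Tam n)"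
proof -
  have "linear_interval P P" for P
    unfolding linear_interval_def using rotations_antisym by blast
  then have "linear_pairs n 0 = (\<lambda>P. (P, P)) ` Tam n"
    by (auto simp: linear_pairs_def Tam_def)
  then show ?thesis by (simp add: card_image inj_on_def)
qed

lemma linear_pairs_empty: "0 < n \<Longrightarrow> n \<le> k \<Longrightarrow> linear_pairs n k = {}"
  by (simp add: linear_pairs_eq climb_pairs_eq_image slide_pairs_empty)

lemma card_linear_pairs_1: "1 < n \<Longrightarrow> card (linear_pairs n 1) = (2 * n - 1 choose (n - 2))"
proof -
  assume n: "1 < n"
  have "climb_pairs n 1 = slide_pairs n 1"
    unfolding climb_pairs_def slide_pairs_def somewhere_slide_1_iff somewhere_climb_1_iff ..
  then have "card (linear_pairs n 1) = card (slide_pairs n 1)" by (simp add: linear_pairs_eq)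
  also have "\<dots> = (2 * n - 1 choose (n - 2))"
    using card_slide_pairs[of 1 n] n by (simp add: numeral_2_eq_2)
  finally show ?thesis .
qed

lemma card_linear_pairs:
  assumes "2 \<le> k" "k < n"
  shows "card (linear_pairs n k) = 2 * (2 * n - k choose (n - k - 1))"
proof -
  have "slide_pairs n k \<inter> climb_pairs n k = {}"
    using slide_climb_less_2 assms(1) by (fastforce simp: slide_pairs_def climb_pairs_def)
  moreover have "finite (slide_pairs n k)" "finite (climb_pairs n k)"
    using finite_slide_pairs[OF assms(2)] by (simp_all add: climb_pairs_eq_image)
  ultimately have "card (linear_pairs n k) = card (slide_pairs n k) + card (climb_pairs n k)"
    using assms by (simp add: linear_pairs_eq card_Un_disjoint)
  with card_slide_pairs[of k n] assms show ?thesis by (simp add: card_climb_pairs)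
qed

text \<open>
  By symmetry the summands are \<open>2 * n - k choose (n + 1)\<close>, so this is the hockey-stick identity.
\<close>

lemma sum_binomials:
  assumes "j \<le> n"
  shows "(\<Sum>k\<in>{j..<n}. 2 * n - k choose (n - k - 1)) = (2 * n - j + 1 choose (n + 2))"
  using assms
proof (induction rule: inc_induct)
  case (step j)
  have "(2 * n - j choose (n - j - 1)) = (2 * n - j choose (n + 1))"
    using step.hyps by (subst binomial_symmetric) (auto intro: arg_cong)
  moreover have "2 * n - Suc j + 1 = 2 * n - j" using step.hyps by simp
  ultimately show ?case using step by (simp add: sum.atLeast_Suc_lessThan)
qed simp

lemma card_linear_intervals:
  assumes "0 < n"
  shows "card (linear_intervals (tamari_order n)) =
    card (Tam n) + card (linear_pairs n 1) + 2 * (2 * n - 1 choose (n + 2))"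
proof -
  have "card (linear_intervals (tamari_order n)) = card (\<Union>k. linear_pairs n k)"
    unfolding linear_intervals_eq_image by (rule card_image[OF inj_on_interval_linear_pairs])
  also have "(\<Union>k. linear_pairs n k) = (\<Union>k<n. linear_pairs n k)"
    using linear_pairs_empty[OF assms] by (auto simp: not_less[symmetric])
  also have "card \<dots> = (\<Sum>k<n. card (linear_pairs n k))"
    by (rule card_UN_disjoint) (auto simp: finite_linear_pairs linear_pairs_disjoint)
  also have "\<dots> = card (Tam n) + card (linear_pairs n 1) + 2 * (2 * n - 1 choose (n + 2))"
  proof (cases "n = 1")
    case True
    then show ?thesis using linear_pairs_empty[of 1 1] card_linear_pairs_0[of 1] by simp
  next
    case False
    with assms have n: "2 \<le> n" by simp
    have "{..<n} = {0, 1} \<union> {2..<n}" using n by auto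
    then have "(\<Sum>k<n. card (linear_pairs n k)) =
        card (linear_pairs n 0) + card (linear_pairs n 1) + (\<Sum>k\<in>{2..<n}. card (linear_pairs n k))"
      by (simp add: sum.union_disjoint)
    also have "(\<Sum>k\<in>{2..<n}. card (linear_pairs n k)) = 2 * (\<Sum>k\<in>{2..<n}. 2 * n - k choose (n - k - 1))"
      unfolding sum_distrib_left by (rule sum.cong) (auto simp: card_linear_pairs)
    also have "(\<Sum>k\<in>{2..<n}. 2 * n - k choose (n - k - 1)) = (2 * n - 1 choose (n + 2))"
    proof -
      have "2 * n - 2 + 1 = 2 * n - 1" using n by simp
      with sum_binomials[OF n] show ?thesis by metis
    qed
    finally show ?thesis by (simp add: card_linear_pairs_0)
  qed
  finally show ?thesis .
qed

lemma int_binomial_of_nat: "int_binomial (int a) (int b) = (a choose b)"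
  by (simp add: int_binomial_def binomial_eq_0)

lemma int_binomial_eq:
  "x = int a \<Longrightarrow> y = int b \<Longrightarrow> int_binomial x y = (a choose b)"
  by (simp add: int_binomial_of_nat)

theorem theorem2p4:
  fixes n :: nat
  assumes "n \<ge> 1"
  shows "real (card (linear_intervals_of_height (tamari_order n) 0))
           = 1 / (real n + 1) * real (int_binomial (2 * int n) (int n))
       \<and> card (linear_intervals_of_height (tamari_order n) 1)
           = int_binomial (2 * int n - 1) (int n - 2)
       \<and> (\<forall>k. 2 \<le> k \<and> k < n \<longrightarrow>
            card (linear_intervals_of_height (tamari_order n) k)
              = 2 * int_binomial (2 * int n - int k) (int n - int k - 1))
       \<and> (\<forall>k\<ge>n. linear_intervals_of_height (tamari_order n) k = {})
       \<and> real (card (linear_intervals (tamari_order n)))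
           = 1 / (real n + 1) * real (int_binomial (2 * int n) (int n))
             + real (int_binomial (2 * int n - 1) (int n - 2))
             + 2 * real (int_binomial (2 * int n - 1) (int n + 2))"
proof -
  have n: "0 < n" using assms by simp
  have "real (n + 1) * real (card (Tam n)) = real (int_binomial (2 * int n) (int n))"
    using card_Tam[of n] int_binomial_eq[of "2 * int n" "2 * n" "int n" n]
    by (metis of_nat_mult of_nat_numeral)
  then have height_0: "real (card (Tam n)) = 1 / (real n + 1) * real (int_binomial (2 * int n) (int n))"
    by (simp add: field_simps)
  have height_1: "card (linear_pairs n 1) = int_binomial (2 * int n - 1) (int n - 2)"
  proof (cases "n = 1")
    case True
    then show ?thesis using linear_pairs_empty[of 1 1] by (simp add: int_binomial_def)
  next
    case False
    with n have "1 < n" by simp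
    then show ?thesis
      unfolding card_linear_pairs_1[OF \<open>1 < n\<close>] by (intro int_binomial_eq[symmetric]) auto
  qed
  have height_k: "card (linear_pairs n k) = 2 * int_binomial (2 * int n - int k) (int n - int k - 1)"
    if "2 \<le> k" "k < n" for k
    using that int_binomial_eq[of "2 * int n - int k" "2 * n - k" "int n - int k - 1" "n - k - 1"]
    by (simp add: card_linear_pairs of_nat_diff)
  have top: "int_binomial (2 * int n - 1) (int n + 2) = (2 * n - 1 choose (n + 2))"
    using n by (intro int_binomial_eq) auto
  have "real (card (linear_intervals (tamari_order n))) =
    real (card (Tam n)) + real (card (linear_pairs n 1)) + 2 * real (2 * n - 1 choose (n + 2))"
    by (simp add: card_linear_intervals[OF n])
  then have total: "real (card (linear_intervals (tamari_order n)))
           = 1 / (real n + 1) * real (int_binomial (2 * int n) (int n))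
             + real (int_binomial (2 * int n - 1) (int n - 2))
             + 2 * real (int_binomial (2 * int n - 1) (int n + 2))"
    unfolding height_0 height_1 top .
  have empty: "linear_intervals_of_height (tamari_order n) k = {}" if "n \<le> k" for k
    using linear_pairs_empty[OF n that] by (simp add: linear_intervals_of_height_eq_image)
  show ?thesis
    unfolding card_linear_intervals_of_height card_linear_pairs_0
    using height_0 height_1 height_k empty total by blast
qed

end
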